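(* Consider objects $(\tilde M\xrightarrow{\pi}M,u)$ where $M$ is a closed smooth manifold, $\pi:\tilde M\to M$ is a connected regular covering and $u\in H^1(M,\mathbb{R})$ is a nonzero class with $\pi^*u=0$. A morphism $(\tilde M_1\xrightarrow{\pi_1} M_1,u_1)\to(\tilde M_2\xrightarrow{\pi_2} M_2,u_2)$ is a pair of smooth maps $\tilde\varphi:\tilde M_1\to\tilde M_2$, $\varphi:M_1\to M_2$ with $\pi_2\circ\tilde\varphi=\varphi\circ\pi_1$ and $u_1=\varphi^*(u_2)$. The Novikov fundamental group is functorial: (1) to each morphism $(\tilde\varphi,\varphi)$ is associated a group homomorphism $\varphi_*:\pi_1(\tilde M_1,u_1)\to\pi_1(\tilde M_2,u_2)$ (the one induced by $\tilde\varphi$ on the quotients by sublevels), which commutes with the corresponding deck transformations: $\varphi_*(\tau\cdot g)=\varphi_*(\tau)\cdot\varphi_*(g)$ for every deck transformation $\tau$ of $\tilde M_1$ and $g\in\pi_1(\tilde M_1,u_1)$, where $\varphi_*(\tau)$ is the deck transformation of $\tilde M_2$ with $\tilde\varphi\circ\tau=\varphi_*(\tau)\circ\tilde\varphi$; (2) if $(\tilde\phi,\phi):(\tilde M_2\to M_2,u_2)\to(\tilde M_3\to M_3,u_3)$ is another morphism, then $[\phi\circ\varphi]_*=\phi_*\circ\varphi_*$.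
   Context: Definition of $\pi_1(\tilde M,u)$: $\mathcal{D}$ is the deck group of $\pi:\tilde M\to M$, and $u$ induces $u:\mathcal{D}\to\mathbb{R}$. For a closed $1$-form $\alpha\in u$ choose $f_\alpha:\tilde M\to\mathbb{R}$ with $df_\alpha=\pi^*\alpha$. For $h\in\mathbb{R}$ let $\lfloor\tilde M\rfloor_h=\tilde M/\{f_\alpha\le h\}$ (sublevel collapsed to a base point $\star_h$) and $\lfloor\pi_1(f_\alpha)\rfloor_h=\pi_1(\lfloor\tilde M\rfloor_h,\star_h)$; for $h<h'$ the projection induces $\zeta_h^{h'}:\lfloor\pi_1(f_\alpha)\rfloor_h\to\lfloor\pi_1(f_\alpha)\rfloor_{h'}$. Set $\pi_1(f_\alpha)=\varprojlim_{h\to-\infty}\lfloor\pi_1(f_\alpha)\rfloor_h$. Since $f_\alpha(\tau x)=f_\alpha(x)+u(\tau)$, each $\tau\in\mathcal{D}$ induces isomorphisms $\lfloor\pi_1(f_\alpha)\rfloor_h\to\lfloor\pi_1(f_\alpha)\rfloor_{h+u(\tau)}$, hence an action of $\mathcal{D}$ on $\pi_1(f_\alpha)$. For two choices $f_\alpha,f_\beta$ the difference is bounded by some $K$ and the inclusions $\{f_\alpha\le h-K\}\subset\{f_\beta\le h\}\subset\{f_\alpha\le h+K\}$ induce a canonical isomorphism $\pi_1(f_\alpha)\cong\pi_1(f_\beta)$; $\pi_1(\tilde M,u)$ denotes the resulting common group. Induced map: if $f_2$ is a primitive on $\tilde M_2$ of $\pi_2^*\alpha_2$, $\alpha_2\in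 u_2$, then $f_1=f_2\circ\tilde\varphi$ is a primitive of $\pi_1^*\varphi^*\alpha_2$ and $\tilde\varphi(\{f_1\le h\})\subset\{f_2\le h\}$; the induced maps $\lfloor\tilde M_1\rfloor_h\to\lfloor\tilde M_2\rfloor_h$ give homomorphisms $\lfloor\pi_1(f_1)\rfloor_h\to\lfloor\pi_1(f_2)\rfloor_h$ compatible with the $\zeta$'s, whose limit is $\varphi_*$. *)

theory Defs
  imports "HOL-Analysis.Analysis" "HOL-Algebra.Product_Groups"
begin

subsection \<open>Smooth functions on open subsets of Euclidean spaces\<close>

text \<open>\<open>Ck k S f\<close>: on the open set \<open>S\<close> the function \<open>f\<close> is of class \<open>C\<^sup>k\<close>, via iterated
  directional derivatives.\<close>

fun Ck :: "nat \<Rightarrow> 'e::euclidean_space set \<Rightarrow> ('e \<Rightarrow> 'f::euclidean_space) \<Rightarrow> bool" where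
  "Ck 0 S f \<longleftrightarrow> continuous_on S f"
| "Ck (Suc k) S f \<longleftrightarrow>
     (\<forall>x\<in>S. f differentiable (at x)) \<and> (\<forall>v. Ck k S (\<lambda>x. frechet_derivative f (at x) v))"

definition smooth_on :: "'e::euclidean_space set \<Rightarrow> ('e \<Rightarrow> 'f::euclidean_space) \<Rightarrow> bool" where
  "smooth_on S f \<longleftrightarrow> open S \<and> (\<forall>k. Ck k S f)"


subsection \<open>Smooth manifolds without boundary\<close>

text \<open>A chart is a domain together with a coordinate map; the coordinate map is only meaningful
  on the domain. Atlases need not be maximal. The model space is the Euclidean space \<open>'e\<close>, so
  the dimension is arbitrary but positive; closed manifolds of dimension zero carry no nonzero
  degree-one class.\<close>

type_synonym ('a, 'e) chart = "'a set \<times> ('a \<Rightarrow> 'e)"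

record ('a, 'e) manifold =
  mtop :: "'a topology"
  atlas :: "('a, 'e) chart set"

definition chart_inv :: "('a, 'e) chart \<Rightarrow> 'e \<Rightarrow> 'a" where
  "chart_inv \<kappa> = inv_into (fst \<kappa>) (snd \<kappa>)"

definition chart_image :: "('a, 'e) chart \<Rightarrow> 'e set" where
  "chart_image \<kappa> = snd \<kappa> ` fst \<kappa>"

abbreviation points :: "('a, 'e) manifold \<Rightarrow> 'a set" where
  "points M \<equiv> topspace (mtop M)"

definition smooth_manifold :: "('a, 'e::euclidean_space) manifold \<Rightarrow> bool" where
  "smooth_manifold M \<longleftrightarrow>
     Hausdorff_space (mtop M) \<and> second_countable (mtop M) \<and>
     (\<Union>\<kappa>\<in>atlas M. fst \<kappa>) = points M \<and>
     (\<forall>\<kappa>\<in>atlas M. openin (mtop M) (fst \<kappa>) \<and> open (chart_image \<kappa>) \<and>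
        homeomorphic_map (subtopology (mtop M) (fst \<kappa>)) (top_of_set (chart_image \<kappa>)) (snd \<kappa>)) \<and>
     (\<forall>\<kappa>\<in>atlas M. \<forall>\<kappa>'\<in>atlas M.
        smooth_on (snd \<kappa> ` (fst \<kappa> \<inter> fst \<kappa>')) (snd \<kappa>' \<circ> chart_inv \<kappa>))"

definition closed_manifold :: "('a, 'e::euclidean_space) manifold \<Rightarrow> bool" where
  "closed_manifold M \<longleftrightarrow> smooth_manifold M \<and> compact_space (mtop M)"

definition smooth_map ::
  "('a, 'e::euclidean_space) manifold \<Rightarrow> ('b, 'f::euclidean_space) manifold \<Rightarrow> ('a \<Rightarrow> 'b) \<Rightarrow> bool" where
  "smooth_map M N \<phi> \<longleftrightarrow>
     continuous_map (mtop M) (mtop N) \<phi> \<and>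
     (\<forall>\<kappa>\<in>atlas M. \<forall>\<kappa>'\<in>atlas N.
        smooth_on (snd \<kappa> ` {p \<in> fst \<kappa>. \<phi> p \<in> fst \<kappa>'}) (snd \<kappa>' \<circ> \<phi> \<circ> chart_inv \<kappa>))"

definition smooth_fun :: "('a, 'e::euclidean_space) manifold \<Rightarrow> ('a \<Rightarrow> real) \<Rightarrow> bool" where
  "smooth_fun M f \<longleftrightarrow> (\<forall>\<kappa>\<in>atlas M. smooth_on (chart_image \<kappa>) (f \<circ> chart_inv \<kappa>))"

definition diffeomorphism ::
  "('a, 'e::euclidean_space) manifold \<Rightarrow> ('b, 'f::euclidean_space) manifold \<Rightarrow> ('a \<Rightarrow> 'b) \<Rightarrow> bool" where
  "diffeomorphism M N \<phi> \<longleftrightarrow> smooth_map M N \<phi> \<and>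
     (\<exists>\<psi>. smooth_map N M \<psi> \<and> (\<forall>x\<in>points M. \<psi> (\<phi> x) = x) \<and> (\<forall>y\<in>points N. \<phi> (\<psi> y) = y))"

definition open_submanifold :: "('a, 'e) manifold \<Rightarrow> 'a set \<Rightarrow> ('a, 'e) manifold" where
  "open_submanifold M U =
     \<lparr>mtop = subtopology (mtop M) U, atlas = (\<lambda>(V, c). (V \<inter> U, c)) ` atlas M\<rparr>"


subsection \<open>Differential one-forms and the first de Rham cohomology\<close>

text \<open>A one-form is given by its coordinate expressions: \<open>\<omega> \<kappa> y v\<close> is the value at the point with
  coordinates \<open>y\<close> in the chart \<open>\<kappa>\<close> on the tangent vector with coordinates \<open>v\<close>. The expressions
  in different charts are related by pullback along the transition maps. They vanish outside the
  charts, so that a form is determined by its values.\<close>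

type_synonym ('a, 'e) form = "('a, 'e) chart \<Rightarrow> 'e \<Rightarrow> 'e \<Rightarrow> real"

definition one_form :: "('a, 'e::euclidean_space) manifold \<Rightarrow> ('a, 'e) form \<Rightarrow> bool" where
  "one_form M \<omega> \<longleftrightarrow>
     (\<forall>\<kappa>\<in>atlas M. \<forall>y\<in>chart_image \<kappa>. linear (\<omega> \<kappa> y)) \<and>
     (\<forall>\<kappa>\<in>atlas M. \<forall>v. smooth_on (chart_image \<kappa>) (\<lambda>y. \<omega> \<kappa> y v)) \<and>
     (\<forall>\<kappa>\<in>atlas M. \<forall>\<kappa>'\<in>atlas M. \<forall>p \<in> fst \<kappa> \<inter> fst \<kappa>'. \<forall>v.
        \<omega> \<kappa> (snd \<kappa> p) v =
        \<omega> \<kappa>' (snd \<kappa>' p) (frechet_derivative (snd \<kappa>' \<circ> chart_inv \<kappa>) (at (snd \<kappa> p)) v)) \<and>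
     (\<forall>\<kappa> y v. \<not> (\<kappa> \<in> atlas M \<and> y \<in> chart_image \<kappa>) \<longrightarrow> \<omega> \<kappa> y v = 0)"

definition closed_form :: "('a, 'e::euclidean_space) manifold \<Rightarrow> ('a, 'e) form \<Rightarrow> bool" where
  "closed_form M \<omega> \<longleftrightarrow> one_form M \<omega> \<and>
     (\<forall>\<kappa>\<in>atlas M. \<forall>y\<in>chart_image \<kappa>. \<forall>v w.
        frechet_derivative (\<lambda>z. \<omega> \<kappa> z w) (at y) v - frechet_derivative (\<lambda>z. \<omega> \<kappa> z v) (at y) w = 0)"

definition differential :: "('a, 'e::euclidean_space) manifold \<Rightarrow> ('a \<Rightarrow> real) \<Rightarrow> ('a, 'e) form" where
  "differential M f = (\<lambda>\<kappa> y v.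
     if \<kappa> \<in> atlas M \<and> y \<in> chart_image \<kappa>
     then frechet_derivative (f \<circ> chart_inv \<kappa>) (at y) v else 0)"

definition exact_form :: "('a, 'e::euclidean_space) manifold \<Rightarrow> ('a, 'e) form \<Rightarrow> bool" where
  "exact_form M \<omega> \<longleftrightarrow> (\<exists>f. smooth_fun M f \<and> \<omega> = differential M f)"

definition cohomologous ::
  "('a, 'e::euclidean_space) manifold \<Rightarrow> (('a, 'e) form \<times> ('a, 'e) form) set" where
  "cohomologous M =
     {(\<alpha>, \<beta>). closed_form M \<alpha> \<and> closed_form M \<beta> \<and> exact_form M (\<lambda>\<kappa> y v. \<beta> \<kappa> y v - \<alpha> \<kappa> y v)}"

definition H1 :: "('a, 'e::euclidean_space) manifold \<Rightarrow> ('a, 'e) form set set" where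
  "H1 M = {\<omega>. closed_form M \<omega>} // cohomologous M"

definition zero_class :: "('a, 'e::euclidean_space) manifold \<Rightarrow> ('a, 'e) form set" where
  "zero_class M = {\<omega>. exact_form M \<omega>}"

text \<open>The value of the pullback does not depend on the chart selected around the image point.\<close>

definition pullback_form ::
  "('a, 'e::euclidean_space) manifold \<Rightarrow> ('b, 'f::euclidean_space) manifold \<Rightarrow> ('a \<Rightarrow> 'b)
     \<Rightarrow> ('b, 'f) form \<Rightarrow> ('a, 'e) form" where
  "pullback_form M N \<phi> \<omega> = (\<lambda>\<kappa> y v.
     if \<kappa> \<in> atlas M \<and> y \<in> chart_image \<kappa> then
       let q = \<phi> (chart_inv \<kappa> y);
           \<kappa>' = (SOME \<kappa>'. \<kappa>' \<in> atlas N \<and> q \<in> fst \<kappa>')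
       in \<omega> \<kappa>' (snd \<kappa>' q) (frechet_derivative (snd \<kappa>' \<circ> \<phi> \<circ> chart_inv \<kappa>) (at y) v)
     else 0)"

definition pullback_class ::
  "('a, 'e::euclidean_space) manifold \<Rightarrow> ('b, 'f::euclidean_space) manifold \<Rightarrow> ('a \<Rightarrow> 'b)
     \<Rightarrow> ('b, 'f) form set \<Rightarrow> ('a, 'e) form set" where
  "pullback_class M N \<phi> u = (\<Union>\<alpha>\<in>u. cohomologous M `` {pullback_form M N \<phi> \<alpha>})"


subsection \<open>The fundamental group of a pointed topological space\<close>

definition loops :: "'a topology \<Rightarrow> 'a \<Rightarrow> (real \<Rightarrow> 'a) set" where
  "loops X x\<^sub>0 = {p. pathin X p \<and> p 0 = x\<^sub>0 \<and> p 1 = x\<^sub>0}"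

definition loop_homotopy :: "'a topology \<Rightarrow> 'a \<Rightarrow> ((real \<Rightarrow> 'a) \<times> (real \<Rightarrow> 'a)) set" where
  "loop_homotopy X x\<^sub>0 =
     {(p, q). homotopic_with (\<lambda>r. r 0 = x\<^sub>0 \<and> r 1 = x\<^sub>0) (top_of_set {0..1}) X p q}"

definition loop_concat :: "(real \<Rightarrow> 'a) \<Rightarrow> (real \<Rightarrow> 'a) \<Rightarrow> real \<Rightarrow> 'a" where
  "loop_concat p q = (\<lambda>t. if t \<le> 1 / 2 then p (2 * t) else q (2 * t - 1))"

definition fundamental_group :: "'a topology \<Rightarrow> 'a \<Rightarrow> (real \<Rightarrow> 'a) set monoid" where
  "fundamental_group X x\<^sub>0 =
     \<lparr>carrier = loops X x\<^sub>0 // loop_homotopy X x\<^sub>0,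
      mult = (\<lambda>A B. \<Union>p\<in>A. \<Union>q\<in>B. loop_homotopy X x\<^sub>0 `` {loop_concat p q}),
      one = loop_homotopy X x\<^sub>0 `` {\<lambda>t. x\<^sub>0}\<rparr>"

text \<open>The map induced by a pointed map into the pointed space \<open>(Y, y\<^sub>0)\<close>.\<close>

definition pi1_map :: "'b topology \<Rightarrow> 'b \<Rightarrow> ('a \<Rightarrow> 'b) \<Rightarrow> (real \<Rightarrow> 'a) set \<Rightarrow> (real \<Rightarrow> 'b) set" where
  "pi1_map Y y\<^sub>0 f A = (\<Union>p\<in>A. loop_homotopy Y y\<^sub>0 `` {f \<circ> p})"


subsection \<open>Collapsing sublevels\<close>

text \<open>The points of the quotient are the singletons outside the sublevel and the sublevel itself,
  which is the base point. (An empty sublevel contributes an isolated base point.)\<close>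

definition sublevel :: "'a topology \<Rightarrow> ('a \<Rightarrow> real) \<Rightarrow> real \<Rightarrow> 'a set" where
  "sublevel X f h = {x \<in> topspace X. f x \<le> h}"

definition collapse :: "'a topology \<Rightarrow> ('a \<Rightarrow> real) \<Rightarrow> real \<Rightarrow> 'a \<Rightarrow> 'a set" where
  "collapse X f h x = (if f x \<le> h then sublevel X f h else {x})"

definition collapsed :: "'a topology \<Rightarrow> ('a \<Rightarrow> real) \<Rightarrow> real \<Rightarrow> 'a set topology" where
  "collapsed X f h = topology (\<lambda>W.
     W \<subseteq> insert (sublevel X f h) (collapse X f h ` topspace X) \<and>
     openin X {x \<in> topspace X. collapse X f h x \<in> W})"

lemma openin_collapsed:
  "openin (collapsed X f h) W \<longleftrightarrow>
     W \<subseteq> insert (sublevel X f h) (collapse X f h ` topspace X) \<and>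
     openin X {x \<in> topspace X. collapse X f h x \<in> W}"
proof -
  have "istopology (\<lambda>W.
     W \<subseteq> insert (sublevel X f h) (collapse X f h ` topspace X) \<and>
     openin X {x \<in> topspace X. collapse X f h x \<in> W})"
    unfolding istopology_def
  proof (intro conjI allI impI)
    fix S T
    assume *: "S \<subseteq> insert (sublevel X f h) (collapse X f h ` topspace X) \<and>
        openin X {x \<in> topspace X. collapse X f h x \<in> S}"
      "T \<subseteq> insert (sublevel X f h) (collapse X f h ` topspace X) \<and>
        openin X {x \<in> topspace X. collapse X f h x \<in> T}"
    show "S \<inter> T \<subseteq> insert (sublevel X f h) (collapse X f h ` topspace X)"
      using * by blast
    have "{x \<in> topspace X. collapse X f h x \<in> S \<inter> T} =
        {x \<in> topspace X. collapse X f h x \<in> S} \<inter> {x \<in> topspace X. collapse X f h x \<in> T}"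
      by blast
    then show "openin X {x \<in> topspace X. collapse X f h x \<in> S \<inter> T}"
      using * by (metis (no_types, lifting) openin_Int)
  next
    fix \<K>
    assume *: "\<forall>K\<in>\<K>. K \<subseteq> insert (sublevel X f h) (collapse X f h ` topspace X) \<and>
        openin X {x \<in> topspace X. collapse X f h x \<in> K}"
    show "\<Union>\<K> \<subseteq> insert (sublevel X f h) (collapse X f h ` topspace X)"
      using * by blast
    have "{x \<in> topspace X. collapse X f h x \<in> \<Union>\<K>} =
        (\<Union>K\<in>\<K>. {x \<in> topspace X. collapse X f h x \<in> K})"
      by blast
    then show "openin X {x \<in> topspace X. collapse X f h x \<in> \<Union>\<K>}"
      using * by auto
  qed
  then show ?thesis
    by (simp add: collapsed_def topology_inverse')
qed

lemma topspace_collapsed: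
  "topspace (collapsed X f h) = insert (sublevel X f h) (collapse X f h ` topspace X)"
proof -
  let ?C = "insert (sublevel X f h) (collapse X f h ` topspace X)"
  have "{x \<in> topspace X. collapse X f h x \<in> ?C} = topspace X"
    by blast
  then have "openin (collapsed X f h) ?C"
    unfolding openin_collapsed by (metis (lifting) openin_topspace subset_refl)
  then show ?thesis
    by (meson openin_collapsed openin_subset openin_topspace subset_antisym)
qed

lemma quotient_map_collapse:
  assumes "sublevel X f h \<noteq> {}"
  shows "quotient_map X (collapsed X f h) (collapse X f h)"
proof -
  have "collapse X f h ` topspace X = topspace (collapsed X f h)"
    using assms unfolding topspace_collapsed by (auto simp: sublevel_def collapse_def)
  then show ?thesis
    unfolding quotient_map_def by (auto simp: openin_collapsed)
qed

definition pi1_level :: "'a topology \<Rightarrow> ('a \<Rightarrow> real) \<Rightarrow> real \<Rightarrow> (real \<Rightarrow> 'a set) set monoid" where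
  "pi1_level X f h = fundamental_group (collapsed X f h) (sublevel X f h)"

text \<open>The pointed map of quotients, and the homomorphism of fundamental groups, induced by a
  continuous map \<open>\<phi>\<close> from \<open>X\<close> to \<open>X'\<close> that maps the sublevel of \<open>f\<close> at \<open>h\<close> into the sublevel
  of \<open>f'\<close> at \<open>h'\<close>.\<close>

definition collapsed_map ::
  "'a topology \<Rightarrow> ('a \<Rightarrow> real) \<Rightarrow> real \<Rightarrow> 'b topology \<Rightarrow> ('b \<Rightarrow> real) \<Rightarrow> real \<Rightarrow> ('a \<Rightarrow> 'b)
     \<Rightarrow> 'a set \<Rightarrow> 'b set" where
  "collapsed_map X f h X' f' h' \<phi> A =
     (if A = sublevel X f h then sublevel X' f' h' else collapse X' f' h' (\<phi> (the_elem A)))"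

definition level_map ::
  "'a topology \<Rightarrow> ('a \<Rightarrow> real) \<Rightarrow> real \<Rightarrow> 'b topology \<Rightarrow> ('b \<Rightarrow> real) \<Rightarrow> real \<Rightarrow> ('a \<Rightarrow> 'b)
     \<Rightarrow> (real \<Rightarrow> 'a set) set \<Rightarrow> (real \<Rightarrow> 'b set) set" where
  "level_map X f h X' f' h' \<phi> =
     pi1_map (collapsed X' f' h') (sublevel X' f' h') (collapsed_map X f h X' f' h' \<phi>)"

abbreviation zeta ::
  "'a topology \<Rightarrow> ('a \<Rightarrow> real) \<Rightarrow> real \<Rightarrow> real \<Rightarrow> (real \<Rightarrow> 'a set) set \<Rightarrow> (real \<Rightarrow> 'a set) set" where
  "zeta X f h h' \<equiv> level_map X f h X f h' (\<lambda>x. x)"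

definition pi1_limit ::
  "'a topology \<Rightarrow> ('a \<Rightarrow> real) \<Rightarrow> (real \<Rightarrow> (real \<Rightarrow> 'a set) set) monoid" where
  "pi1_limit X f = (product_group UNIV (pi1_level X f))
     \<lparr>carrier := {g. (\<forall>h. g h \<in> carrier (pi1_level X f h)) \<and>
                     (\<forall>h h'. h < h' \<longrightarrow> zeta X f h h' (g h) = g h')}\<rparr>"

text \<open>The comparison of limits for two functions with \<open>\<bar>f - f'\<bar> \<le> K\<close>, induced by the inclusion of
  the sublevel of \<open>f\<close> at \<open>h - K\<close> into that of \<open>f'\<close> at \<open>h\<close>. It does not depend on the bound.\<close>

definition comparison ::
  "'a topology \<Rightarrow> ('a \<Rightarrow> real) \<Rightarrow> ('a \<Rightarrow> real) \<Rightarrow> real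
     \<Rightarrow> (real \<Rightarrow> (real \<Rightarrow> 'a set) set) \<Rightarrow> (real \<Rightarrow> (real \<Rightarrow> 'a set) set)" where
  "comparison X f f' K g = (\<lambda>h. level_map X f (h - K) X f' h (\<lambda>x. x) (g (h - K)))"


subsection \<open>Regular coverings with a cohomology class\<close>

record ('a, 'b, 'e) covering_class =
  cover :: "('a, 'e) manifold"
  base :: "('b, 'e) manifold"
  proj :: "'a \<Rightarrow> 'b"
  cls :: "('b, 'e) form set"

definition smooth_covering ::
  "('a, 'e::euclidean_space) manifold \<Rightarrow> ('b, 'e) manifold \<Rightarrow> ('a \<Rightarrow> 'b) \<Rightarrow> bool" where
  "smooth_covering M N p \<longleftrightarrow>
     smooth_map M N p \<and> p ` points M = points N \<and>
     (\<forall>y\<in>points N. \<exists>U. openin (mtop N) U \<and> y \<in> U \<and>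
        (\<exists>\<V>. pairwise disjnt \<V> \<and> \<Union>\<V> = {x \<in> points M. p x \<in> U} \<and>
           (\<forall>V\<in>\<V>. openin (mtop M) V \<and>
              diffeomorphism (open_submanifold M V) (open_submanifold N U) p)))"

text \<open>Deck transformations are extensional functions, so that they are determined by their values
  on the covering space.\<close>

definition deck_group :: "('a, 'b, 'e) covering_class \<Rightarrow> ('a \<Rightarrow> 'a) set" where
  "deck_group C = {\<tau> \<in> extensional (points (cover C)).
     homeomorphic_map (mtop (cover C)) (mtop (cover C)) \<tau> \<and>
     (\<forall>x\<in>points (cover C). proj C (\<tau> x) = proj C x)}"

definition novikov_object :: "('a, 'b, 'e::euclidean_space) covering_class \<Rightarrow> bool" where
  "novikov_object C \<longleftrightarrow>
     closed_manifold (base C) \<and> smooth_manifold (cover C) \<and> connected_space (mtop (cover C)) \<and>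
     smooth_covering (cover C) (base C) (proj C) \<and>
     (\<forall>x\<in>points (cover C). \<forall>y\<in>points (cover C).
        proj C x = proj C y \<longrightarrow> (\<exists>\<tau>\<in>deck_group C. \<tau> x = y)) \<and>
     cls C \<in> H1 (base C) \<and> cls C \<noteq> zero_class (base C) \<and>
     pullback_class (cover C) (base C) (proj C) (cls C) = zero_class (cover C)"

definition novikov_morphism ::
  "('a, 'b, 'e::euclidean_space) covering_class \<Rightarrow> ('c, 'd, 'f::euclidean_space) covering_class
     \<Rightarrow> ('a \<Rightarrow> 'c) \<Rightarrow> ('b \<Rightarrow> 'd) \<Rightarrow> bool" where
  "novikov_morphism C D \<phi>t \<phi> \<longleftrightarrow>
     smooth_map (cover C) (cover D) \<phi>t \<and> smooth_map (base C) (base D) \<phi> \<and>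
     (\<forall>x\<in>points (cover C). proj D (\<phi>t x) = \<phi> (proj C x)) \<and>
     cls C = pullback_class (base C) (base D) \<phi> (cls D)"

text \<open>All functions \<open>f\<^sub>\<alpha>\<close> with \<open>df\<^sub>\<alpha> = \<pi>\<^sup>*\<alpha>\<close>, for all closed forms \<open>\<alpha>\<close> in the given class.\<close>

definition primitives :: "('a, 'b, 'e::euclidean_space) covering_class \<Rightarrow> ('a \<Rightarrow> real) set" where
  "primitives C = {f \<in> extensional (points (cover C)). smooth_fun (cover C) f \<and>
     (\<exists>\<alpha>\<in>cls C. differential (cover C) f = pullback_form (cover C) (base C) (proj C) \<alpha>)}"

text \<open>The homomorphism \<open>u\<close> from the deck group to the reals.\<close>

definition deck_period :: "('a, 'b, 'e::euclidean_space) covering_class \<Rightarrow> ('a \<Rightarrow> 'a) \<Rightarrow> real" where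
  "deck_period C \<tau> =
     (THE r. \<forall>f\<in>primitives C. \<forall>x\<in>points (cover C). f (\<tau> x) = f x + r)"


subsection \<open>The Novikov fundamental group\<close>

text \<open>The common group of the canonically isomorphic groups \<open>pi1_limit X f\<close>: an element is a choice,
  for every primitive \<open>f\<close>, of an element of the limit group of \<open>f\<close>, such that these choices
  correspond to each other under the canonical isomorphisms. Evaluation at a given \<open>f\<close> identifies
  it with \<open>pi1_limit X f\<close>.\<close>

type_synonym 'a novikov_element = "('a \<Rightarrow> real) \<Rightarrow> real \<Rightarrow> (real \<Rightarrow> 'a set) set"

definition novikov_pi1 ::
  "('a, 'b, 'e::euclidean_space) covering_class \<Rightarrow> 'a novikov_element monoid" where
  "novikov_pi1 C = (let X = mtop (cover C) in
     (product_group (primitives C) (pi1_limit X))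
     \<lparr>carrier := {G \<in> (\<Pi>\<^sub>E f\<in>primitives C. carrier (pi1_limit X f)).
        \<forall>f\<in>primitives C. \<forall>f'\<in>primitives C. \<forall>K.
          (\<forall>x\<in>topspace X. \<bar>f x - f' x\<bar> \<le> K) \<longrightarrow> comparison X f f' K (G f) = G f'}\<rparr>)"

definition deck_action ::
  "('a, 'b, 'e::euclidean_space) covering_class \<Rightarrow> ('a \<Rightarrow> 'a)
     \<Rightarrow> 'a novikov_element \<Rightarrow> 'a novikov_element" where
  "deck_action C \<tau> G = (let X = mtop (cover C) in
     restrict (\<lambda>f h.
       level_map X f (h - deck_period C \<tau>) X f h \<tau> (G f (h - deck_period C \<tau>)))
       (primitives C))"

text \<open>The component of \<open>\<phi>\<^sub>* G\<close> at \<open>f\<^sub>2\<close> is the image of the component of \<open>G\<close> at the primitive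
  \<open>f\<^sub>1 = f\<^sub>2 \<circ> \<phi>t\<close>. Only the map \<open>\<phi>t\<close> of the covering spaces enters.\<close>

definition novikov_map ::
  "('a, 'b, 'e::euclidean_space) covering_class \<Rightarrow> ('c, 'd, 'f::euclidean_space) covering_class
     \<Rightarrow> ('a \<Rightarrow> 'c) \<Rightarrow> 'a novikov_element \<Rightarrow> 'c novikov_element" where
  "novikov_map C D \<phi>t G =
     restrict (\<lambda>f\<^sub>2 h.
        let f\<^sub>1 = restrict (f\<^sub>2 \<circ> \<phi>t) (points (cover C)) in
        level_map (mtop (cover C)) f\<^sub>1 h (mtop (cover D)) f\<^sub>2 h \<phi>t (G f\<^sub>1 h))
       (primitives D)"

definition covers_deck ::
  "('a, 'b, 'e) covering_class \<Rightarrow> ('c, 'd, 'f) covering_class \<Rightarrow> ('a \<Rightarrow> 'c) \<Rightarrow> ('a \<Rightarrow> 'a)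
     \<Rightarrow> ('c \<Rightarrow> 'c) \<Rightarrow> bool" where
  "covers_deck C D \<phi>t \<tau> \<sigma> \<longleftrightarrow>
     \<sigma> \<in> deck_group D \<and> (\<forall>x\<in>points (cover C). \<phi>t (\<tau> x) = \<sigma> (\<phi>t x))"

definition induced_deck ::
  "('a, 'b, 'e) covering_class \<Rightarrow> ('c, 'd, 'f) covering_class \<Rightarrow> ('a \<Rightarrow> 'c) \<Rightarrow> ('a \<Rightarrow> 'a)
     \<Rightarrow> ('c \<Rightarrow> 'c)" where
  "induced_deck C D \<phi>t \<tau> = (THE \<sigma>. covers_deck C D \<phi>t \<tau> \<sigma>)"

end

theory Submission
  imports Defs
begin

text \<open>A continuous map that sends the sublevel of \<open>f\<close> at \<open>h - r\<close> into that of \<open>f'\<close> at \<open>h\<close>, for all \<open>h\<close>,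
  descends to the quotients by sublevels and induces a homomorphism of limit groups,
  functorially in the map and additively in \<open>r\<close>. This gives everything once the maps in question
  are seen to be of this kind. For a morphism this amounts to \<open>f\<^sub>2 \<circ> \<phi>t\<close> being a primitive whenever
  \<open>f\<^sub>2\<close> is one, which is the functoriality of the pullback of forms. For a deck transformation
  \<open>\<tau>\<close>, \<open>f \<circ> \<tau> - f\<close> has zero differential, hence is a constant \<open>u \<tau>\<close>, and it does not depend on \<open>f\<close>
  since two primitives differ by a constant and a function lifted from the base. The deck
  transformation covering \<open>\<tau>\<close> exists since \<open>\<phi>t \<circ> \<tau>\<close> and \<open>\<phi>t\<close> are lifts of the same map and the target
  covering is regular; it is unique by uniqueness of lifts, and \<open>f\<^sub>2 \<circ> \<phi>t\<close> shows that it has the same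
  period as \<open>\<tau>\<close>.\<close>

subsection \<open>Calculus of smooth functions\<close>

text \<open>An element of the Novikov group is a family indexed by all primitives, so no primitive
  has to be chosen: the component of an image at \<open>f\<close> comes from the component at
  \<open>f \<circ> \<phi>t\<close>, and equations are checked one component at a time. Shifts are
  recorded so that level \<open>h - r\<close> goes to level \<open>h\<close>; a square commutes once
  both ways round induce the same map of spaces and have the same total shift.

  The delicate point is membership of forms in classes. A class contains closed forms only, so a
  pulled back representative must be known to be closed before it can lie in the class. Closedness
  is transported along exact differences, and this is what the symmetry of second derivatives is
  proved for.

  The two conditions on \<open>u\<close> enter at different places. The vanishing of its pullback to
  the covering yields a primitive, against which the periods of a deck transformation and of the
  induced one are compared. The nonvanishing of \<open>u\<close> excludes the empty covering space
  and so provides a point at which lifts and periods can be compared.\<close>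

lemma Ck_Suc_imp: "Ck (Suc k) S f \<Longrightarrow> Ck k S f"
proof (induction k arbitrary: f)
  case 0
  then show ?case
    by (auto intro!: continuous_at_imp_continuous_on differentiable_imp_continuous_within)
qed auto

lemma Ck_cong:
  assumes "open S" "\<And>x. x \<in> S \<Longrightarrow> f x = g x" "Ck k S f"
  shows "Ck k S g"
  using assms(2,3)
proof (induction k arbitrary: f g)
  case 0
  then show ?case by (metis Ck.simps(1) continuous_on_cong)
next
  case (Suc k)
  have "g differentiable (at x)" if "x \<in> S" for x
  proof -
    obtain D where "(f has_derivative D) (at x)"
      using Suc.prems(2) \<open>x \<in> S\<close> by (auto simp: differentiable_def)
    then have "(g has_derivative D) (at x)"
      using has_derivative_transform_within_open[OF _ \<open>open S\<close> \<open>x \<in> S\<close>] Suc.prems(1) by blast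
    then show ?thesis by (auto simp: differentiable_def)
  qed
  moreover have "Ck k S (\<lambda>x. frechet_derivative g (at x) v)" for v
  proof (rule Suc.IH)
    show "Ck k S (\<lambda>x. frechet_derivative f (at x) v)"
      using Suc.prems by simp
    show "frechet_derivative f (at x) v = frechet_derivative g (at x) v" if "x \<in> S" for x
      using frechet_derivative_transform_within_open[of f x S g] Suc.prems that \<open>open S\<close> by simp
  qed
  ultimately show ?case by simp
qed

lemma Ck_subset: "Ck k S f \<Longrightarrow> T \<subseteq> S \<Longrightarrow> Ck k T f"
  by (induction k arbitrary: f) (auto intro: continuous_on_subset)

lemma Ck_local:
  assumes "\<And>x. x \<in> S \<Longrightarrow> \<exists>U. open U \<and> x \<in> U \<and> Ck k U f"
  shows "Ck k S f"
  using assms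
proof (induction k arbitrary: f)
  case 0
  have "continuous (at x) f" if "x \<in> S" for x
    using 0[OF that] by (auto simp: continuous_on_eq_continuous_at)
  then show ?case
    by (simp add: continuous_at_imp_continuous_on)
next
  case (Suc k)
  have "f differentiable (at x)" if "x \<in> S" for x
    using Suc.prems[OF that] by auto
  moreover have "Ck k S (\<lambda>x. frechet_derivative f (at x) v)" for v
  proof (rule Suc.IH)
    show "\<exists>U. open U \<and> x \<in> U \<and> Ck k U (\<lambda>x. frechet_derivative f (at x) v)" if "x \<in> S" for x
      using Suc.prems[OF that] by auto
  qed
  ultimately show ?case by simp
qed

lemma Ck_const: "Ck k S (\<lambda>x. c)"
  by (induction k arbitrary: c) auto

lemma Ck_add:
  assumes "open S" "Ck k S f" "Ck k S g"
  shows "Ck k S (\<lambda>x. f x + g x)"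
  using assms(2,3)
proof (induction k arbitrary: f g)
  case (Suc k)
  have "Ck k S (\<lambda>x. frechet_derivative (\<lambda>x. f x + g x) (at x) v)" for v
  proof (rule Ck_cong[OF \<open>open S\<close>])
    show "Ck k S (\<lambda>x. frechet_derivative f (at x) v + frechet_derivative g (at x) v)"
      using Suc by simp
    show "frechet_derivative f (at x) v + frechet_derivative g (at x) v
        = frechet_derivative (\<lambda>x. f x + g x) (at x) v" if "x \<in> S" for x
      using Suc.prems that
      by (auto simp: frechet_derivative_works intro!: fun_cong[OF frechet_derivative_at] has_derivative_add)
  qed
  then show ?case
    using Suc.prems by (auto intro: differentiable_add)
qed (auto intro: continuous_on_add)

lemma Ck_linear:
  assumes "open S" "bounded_linear L" "Ck k S f"
  shows "Ck k S (\<lambda>x. L (f x))"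
  using assms(3)
proof (induction k arbitrary: f)
  case 0
  then show ?case
    using assms(2) by (simp add: bounded_linear.continuous_on)
next
  case (Suc k)
  have der: "((\<lambda>x. L (f x)) has_derivative (\<lambda>v. L (frechet_derivative f (at x) v))) (at x)"
    if "x \<in> S" for x
    using Suc.prems that
    by (auto simp: frechet_derivative_works intro: bounded_linear.has_derivative[OF assms(2)])
  have "Ck k S (\<lambda>x. frechet_derivative (\<lambda>x. L (f x)) (at x) v)" for v
  proof (rule Ck_cong[OF \<open>open S\<close>])
    show "Ck k S (\<lambda>x. L (frechet_derivative f (at x) v))"
      using Suc by simp
    show "L (frechet_derivative f (at x) v) = frechet_derivative (\<lambda>x. L (f x)) (at x) v"
      if "x \<in> S" for x
      using fun_cong[OF frechet_derivative_at[OF der[OF that]]] .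
  qed
  then show ?case
    using der by (auto simp: differentiable_def)
qed

lemma Ck_sum:
  assumes "open S" "finite I" "\<And>i. i \<in> I \<Longrightarrow> Ck k S (f i)"
  shows "Ck k S (\<lambda>x. \<Sum>i\<in>I. f i x)"
  using assms(2,3) by (induction I) (auto intro: Ck_const Ck_add[OF \<open>open S\<close>])

lemma Ck_scaleR:
  fixes a :: "'e::euclidean_space \<Rightarrow> real"
  assumes "open S" "Ck k S a" "Ck k S f"
  shows "Ck k S (\<lambda>x. a x *\<^sub>R f x)"
  using assms(2,3)
proof (induction k arbitrary: a f)
  case (Suc k)
  have der: "((\<lambda>x. a x *\<^sub>R f x) has_derivative
      (\<lambda>v. a x *\<^sub>R frechet_derivative f (at x) v + frechet_derivative a (at x) v *\<^sub>R f x)) (at x)"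
    if "x \<in> S" for x
    using Suc.prems that
    by (auto simp: frechet_derivative_works intro: has_derivative_scaleR)
  have "Ck k S (\<lambda>x. frechet_derivative (\<lambda>x. a x *\<^sub>R f x) (at x) v)" for v
  proof (rule Ck_cong[OF \<open>open S\<close>])
    \<comment> \<open>The product rule also contains the undifferentiated factors \<open>a\<close>
      and \<open>f\<close>, which have to be lowered by one degree of smoothness before the
      induction hypothesis applies.\<close>
    show "Ck k S (\<lambda>x. a x *\<^sub>R frechet_derivative f (at x) v + frechet_derivative a (at x) v *\<^sub>R f x)"
      using Suc Ck_Suc_imp[of k S a] Ck_Suc_imp[of k S f] by (intro Ck_add \<open>open S\<close>) auto
    show "a x *\<^sub>R frechet_derivative f (at x) v + frechet_derivative a (at x) v *\<^sub>R f x
        = frechet_derivative (\<lambda>x. a x *\<^sub>R f x) (at x) v" if "x \<in> S" for x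
      using fun_cong[OF frechet_derivative_at[OF der[OF that]]] .
  qed
  then show ?case
    using der by (auto simp: differentiable_def)
qed (auto intro: continuous_on_scaleR)

text \<open>\<open>Ck\<close> speaks about derivatives in a fixed direction, whereas in the chain
  rule the direction at which the outer derivative is taken varies with the point. Expanding that
  direction in the basis leaves products of scalar coefficients with derivatives of \<open>g\<close>
  in constant directions.\<close>

lemma frechet_derivative_comp_basis:
  fixes f :: "'e::euclidean_space \<Rightarrow> 'f::euclidean_space"
  assumes "f differentiable (at x)" "g differentiable (at (f x))"
  shows "frechet_derivative (g \<circ> f) (at x) v
    = (\<Sum>b\<in>Basis. (frechet_derivative f (at x) v \<bullet> b) *\<^sub>R frechet_derivative g (at (f x)) b)"
proof -
  have "frechet_derivative (g \<circ> f) (at x) v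
      = frechet_derivative g (at (f x)) (\<Sum>b\<in>Basis. (frechet_derivative f (at x) v \<bullet> b) *\<^sub>R b)"
    using assms by (simp add: frechet_derivative_compose euclidean_representation)
  then show ?thesis
    using linear_frechet_derivative[OF assms(2)] by (simp add: linear_sum linear_cmul)
qed

text \<open>Induction with \<open>f\<close> fixed and \<open>g\<close> varying: by the basis form of
  the chain rule, a directional derivative of \<open>g \<circ> f\<close> is a sum of coefficients of
  the derivative of \<open>f\<close> times compositions of directional derivatives of
  \<open>g\<close> with the same \<open>f\<close>.\<close>

lemma Ck_compose:
  fixes f :: "'e::euclidean_space \<Rightarrow> 'f::euclidean_space" and g :: "'f \<Rightarrow> 'g::euclidean_space"
  assumes "open S" "Ck k S f" "Ck k T g" "f ` S \<subseteq> T"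
  shows "Ck k S (g \<circ> f)"
  using assms(2,3)
proof (induction k arbitrary: g)
  case 0
  then show ?case
    using assms(4) continuous_on_compose2[of T g S f] by (simp add: o_def)
next
  case (Suc k)
  have f: "f differentiable (at x)" and g: "g differentiable (at (f x))" if "x \<in> S" for x
    using Suc.prems assms(4) that by auto
  have "Ck k S (\<lambda>x. frechet_derivative (g \<circ> f) (at x) v)" for v
  proof (rule Ck_cong[OF \<open>open S\<close>])
    have "Ck k S (\<lambda>x. frechet_derivative f (at x) v \<bullet> b)" for b
      using Suc.prems(1) by (intro Ck_linear[OF \<open>open S\<close> bounded_linear_inner_left]) simp
    moreover have "Ck k S ((\<lambda>y. frechet_derivative g (at y) b) \<circ> f)" for b
      using Suc.prems by (intro Suc.IH Ck_Suc_imp[of k S f]) auto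
    ultimately show "Ck k S (\<lambda>x. \<Sum>b\<in>Basis. (frechet_derivative f (at x) v \<bullet> b) *\<^sub>R
        frechet_derivative g (at (f x)) b)"
      by (intro Ck_sum Ck_scaleR \<open>open S\<close>) (auto simp: o_def)
    show "(\<Sum>b\<in>Basis. (frechet_derivative f (at x) v \<bullet> b) *\<^sub>R frechet_derivative g (at (f x)) b)
        = frechet_derivative (g \<circ> f) (at x) v" if "x \<in> S" for x
      using frechet_derivative_comp_basis[OF f g] that by simp
  qed
  moreover have "g \<circ> f differentiable (at x)" if "x \<in> S" for x
    using differentiable_chain_at[OF f g] that by simp
  ultimately show ?case unfolding Ck.simps by blast
qed

lemma smooth_on_open: "smooth_on S f \<Longrightarrow> open S"
  by (simp add: smooth_on_def)

lemma smooth_on_differentiable: "smooth_on S f \<Longrightarrow> x \<in> S \<Longrightarrow> f differentiable (at x)"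
  by (meson Ck.simps(2) smooth_on_def)

lemma smooth_on_derivative: "smooth_on S f \<Longrightarrow> smooth_on S (\<lambda>x. frechet_derivative f (at x) v)"
  unfolding smooth_on_def using Ck.simps(2)[of _ S f] by blast

lemma smooth_on_continuous_on: "smooth_on S f \<Longrightarrow> continuous_on S f"
  by (meson Ck.simps(1) smooth_on_def)

lemma smooth_on_cong: "smooth_on S f \<Longrightarrow> (\<And>x. x \<in> S \<Longrightarrow> f x = g x) \<Longrightarrow> smooth_on S g"
  by (meson Ck_cong smooth_on_def)

lemma smooth_on_subset: "smooth_on S f \<Longrightarrow> open T \<Longrightarrow> T \<subseteq> S \<Longrightarrow> smooth_on T f"
  by (meson Ck_subset smooth_on_def)

lemma smooth_on_local:
  assumes "\<And>x. x \<in> S \<Longrightarrow> \<exists>U. x \<in> U \<and> U \<subseteq> S \<and> smooth_on U f"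
  shows "smooth_on S f"
proof -
  have "open S"
    unfolding open_subopen[of S] using assms smooth_on_open by blast
  moreover have "Ck k S f" for k
    using assms unfolding smooth_on_def by (intro Ck_local) blast
  ultimately show ?thesis by (simp add: smooth_on_def)
qed

lemma smooth_on_const: "open S \<Longrightarrow> smooth_on S (\<lambda>x. c)"
  by (simp add: smooth_on_def Ck_const)

lemma smooth_on_add: "smooth_on S f \<Longrightarrow> smooth_on S g \<Longrightarrow> smooth_on S (\<lambda>x. f x + g x)"
  by (simp add: smooth_on_def Ck_add)

lemma smooth_on_diff:
  assumes "smooth_on S f" "smooth_on S g" shows "smooth_on S (\<lambda>x. f x - g x)"
proof -
  have "smooth_on S (\<lambda>x. - g x)"
    using assms(2) by (simp add: smooth_on_def Ck_linear bounded_linear_minus bounded_linear_ident)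
  from smooth_on_add[OF assms(1) this] show ?thesis by simp
qed

lemma smooth_on_compose:
  "smooth_on S f \<Longrightarrow> smooth_on T g \<Longrightarrow> f ` S \<subseteq> T \<Longrightarrow> smooth_on S (g \<circ> f)"
  unfolding smooth_on_def by (blast intro: Ck_compose)

text \<open>Two applications of the mean value theorem to the second difference of \<open>f\<close> in the
  directions \<open>s *\<^sub>R v\<close> and \<open>s *\<^sub>R w\<close>.\<close>

lemma second_difference:
  fixes f :: "'e::euclidean_space \<Rightarrow> real"
  assumes f: "smooth_on S f" and S: "cball x r \<subseteq> S" and s: "0 < s" "s * (norm v + norm w) \<le> r"
  obtains z where "dist z x \<le> s * (norm v + norm w)"
    "f (x + s *\<^sub>R v + s *\<^sub>R w) - f (x + s *\<^sub>R v) - f (x + s *\<^sub>R w) + f x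
      = s * s * frechet_derivative (\<lambda>z. frechet_derivative f (at z) v) (at z) w"
proof -
  let ?D = "\<lambda>v z. frechet_derivative f (at z) v"
  have near: "dist (x + a *\<^sub>R v + b *\<^sub>R w) x \<le> s * (norm v + norm w)"
    if "0 \<le> a" "a \<le> s" "0 \<le> b" "b \<le> s" for a b
  proof -
    have "norm (a *\<^sub>R v + b *\<^sub>R w) \<le> a * norm v + b * norm w"
      using norm_triangle_ineq[of "a *\<^sub>R v" "b *\<^sub>R w"] that by simp
    also have "\<dots> \<le> s * norm v + s * norm w"
      using that by (intro add_mono mult_right_mono) auto
    finally show ?thesis by (simp add: dist_norm distrib_left add.assoc)
  qed
  have inS: "x + a *\<^sub>R v + b *\<^sub>R w \<in> S" if "0 \<le> a" "a \<le> s" "0 \<le> b" "b \<le> s" for a b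
    using near[OF that] S s by (auto simp: dist_commute)
  have line: "((\<lambda>t. g (p + t *\<^sub>R e)) has_real_derivative frechet_derivative g (at (p + t *\<^sub>R e)) e) (at t)"
    if "g differentiable (at (p + t *\<^sub>R e))" for g :: "'e \<Rightarrow> real" and p e t
  proof -
    have "((\<lambda>t. p + t *\<^sub>R e) has_derivative (\<lambda>h. h *\<^sub>R e)) (at t)"
      by (auto intro!: derivative_eq_intros)
    moreover have "(g has_derivative frechet_derivative g (at (p + t *\<^sub>R e))) (at (p + t *\<^sub>R e))"
      using that by (simp add: frechet_derivative_works)
    ultimately have "(g \<circ> (\<lambda>t. p + t *\<^sub>R e) has_derivative
        frechet_derivative g (at (p + t *\<^sub>R e)) \<circ> (\<lambda>h. h *\<^sub>R e)) (at t)"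
      by (rule diff_chain_at)
    then show ?thesis
      using linear_frechet_derivative[OF that]
      by (simp add: has_field_derivative_def o_def linear_cmul mult.commute[of _ "frechet_derivative g _ _"])
  qed
  \<comment> \<open>The second difference is \<open>g s - g 0\<close>. The first mean value theorem
    moves along \<open>v\<close> and leaves an increment in the direction \<open>w\<close> of the
    derivative along \<open>v\<close>; the second one moves along \<open>w\<close>.\<close>
  define g where "g t = f ((x + s *\<^sub>R w) + t *\<^sub>R v) - f (x + t *\<^sub>R v)" for t
  have "(g has_real_derivative ?D v ((x + s *\<^sub>R w) + t *\<^sub>R v) - ?D v (x + t *\<^sub>R v)) (at t)"
    if "0 \<le> t" "t \<le> s" for t
    unfolding g_def
    using inS[of t s] inS[of t 0] that s(1) f
    by (intro DERIV_diff line) (auto intro: smooth_on_differentiable simp: algebra_simps)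
  from MVT2[OF s(1) this] obtain t where t: "0 < t" "t < s"
    "g s - g 0 = s * (?D v ((x + s *\<^sub>R w) + t *\<^sub>R v) - ?D v (x + t *\<^sub>R v))"
    by auto
  have "((\<lambda>b. ?D v ((x + t *\<^sub>R v) + b *\<^sub>R w)) has_real_derivative
      frechet_derivative (?D v) (at ((x + t *\<^sub>R v) + b *\<^sub>R w)) w) (at b)" if "0 \<le> b" "b \<le> s" for b
    using inS[of t b] that t s(1)
    by (intro line smooth_on_differentiable[OF smooth_on_derivative[OF f]]) auto
  from MVT2[OF s(1) this] obtain b where b: "0 < b" "b < s"
    "?D v ((x + t *\<^sub>R v) + s *\<^sub>R w) - ?D v (x + t *\<^sub>R v)
      = s * frechet_derivative (?D v) (at ((x + t *\<^sub>R v) + b *\<^sub>R w)) w"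
    by auto
  show thesis
  proof
    show "dist (x + t *\<^sub>R v + b *\<^sub>R w) x \<le> s * (norm v + norm w)"
      using near t b by simp
    have "f (x + s *\<^sub>R v + s *\<^sub>R w) - f (x + s *\<^sub>R v) - f (x + s *\<^sub>R w) + f x = g s - g 0"
      by (simp add: g_def algebra_simps)
    also have "\<dots> = s * (?D v ((x + t *\<^sub>R v) + s *\<^sub>R w) - ?D v (x + t *\<^sub>R v))"
      using t(3) by (simp add: algebra_simps)
    finally show "f (x + s *\<^sub>R v + s *\<^sub>R w) - f (x + s *\<^sub>R v) - f (x + s *\<^sub>R w) + f x
        = s * s * frechet_derivative (?D v) (at (x + t *\<^sub>R v + b *\<^sub>R w)) w"
      by (simp add: b(3))
  qed
qed

text \<open>The second difference is symmetric in \<open>v\<close> and \<open>w\<close>, so each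
  mixed derivative, taken at a suitable point near \<open>x\<close>, equals the same quotient. If
  they differed at \<open>x\<close>, continuity would keep both within half of the gap on a small
  ball, a contradiction.\<close>

lemma symmetric_second_derivative:
  fixes f :: "'e::euclidean_space \<Rightarrow> real"
  assumes f: "smooth_on S f" and "x \<in> S"
  shows "frechet_derivative (\<lambda>z. frechet_derivative f (at z) v) (at x) w
       = frechet_derivative (\<lambda>z. frechet_derivative f (at z) w) (at x) v"
proof (rule ccontr)
  let ?A = "\<lambda>z. frechet_derivative (\<lambda>z. frechet_derivative f (at z) v) (at z) w"
  let ?B = "\<lambda>z. frechet_derivative (\<lambda>z. frechet_derivative f (at z) w) (at z) v"
  assume "?A x \<noteq> ?B x"
  define e where "e = \<bar>?A x - ?B x\<bar> / 2"
  have "e > 0" using \<open>?A x \<noteq> ?B x\<close> by (simp add: e_def)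
  have cont: "continuous (at x) ?A" "continuous (at x) ?B"
    using smooth_on_continuous_on[OF smooth_on_derivative[OF smooth_on_derivative[OF f]]]
      smooth_on_open[OF f] \<open>x \<in> S\<close> continuous_on_eq_continuous_at by blast+
  obtain d1 where d1: "d1 > 0" "\<And>z. dist z x < d1 \<Longrightarrow> dist (?A z) (?A x) < e"
    using cont(1) \<open>e > 0\<close> unfolding continuous_at_eps_delta dist_real_def[symmetric] dist_norm[symmetric] by blast
  obtain d2 where d2: "d2 > 0" "\<And>z. dist z x < d2 \<Longrightarrow> dist (?B z) (?B x) < e"
    using cont(2) \<open>e > 0\<close> unfolding continuous_at_eps_delta dist_real_def[symmetric] dist_norm[symmetric] by blast
  obtain r0 where r0: "r0 > 0" "cball x r0 \<subseteq> S"
    using smooth_on_open[OF f] \<open>x \<in> S\<close> open_contains_cball by blast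
  define r where "r = Min {r0, d1 / 2, d2 / 2}"
  have r: "r > 0" "cball x r \<subseteq> S" "r < d1" "r < d2"
    using r0 d1(1) d2(1) by (auto simp: r_def min_def)
  \<comment> \<open>The summand 1 keeps the denominator positive when \<open>v\<close> and
    \<open>w\<close> both vanish.\<close>
  define s where "s = r / (norm v + norm w + 1)"
  have pos: "norm v + norm w + 1 > 0"
    using norm_ge_zero[of v] norm_ge_zero[of w] by linarith
  then have s: "s > 0" using r(1) by (simp add: s_def)
  have "s * (norm v + norm w) \<le> s * (norm v + norm w + 1)"
    using s by (intro mult_left_mono) auto
  also have "\<dots> = r" using pos by (simp add: s_def)
  finally have sr: "s * (norm v + norm w) \<le> r" .
  obtain z where z: "dist z x \<le> s * (norm v + norm w)"
    "f (x + s *\<^sub>R v + s *\<^sub>R w) - f (x + s *\<^sub>R v) - f (x + s *\<^sub>R w) + f x = s * s * ?A z"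
    using second_difference[OF f r(2) s sr] .
  obtain z' where z': "dist z' x \<le> s * (norm w + norm v)"
    "f (x + s *\<^sub>R w + s *\<^sub>R v) - f (x + s *\<^sub>R w) - f (x + s *\<^sub>R v) + f x = s * s * ?B z'"
    using second_difference[OF f r(2) s, of w v] sr by (auto simp: add.commute)
  have "s * s * ?A z = s * s * ?B z'"
    using z(2) z'(2) by (simp add: algebra_simps)
  then have "?A z = ?B z'" using s by simp
  moreover have "dist (?A z) (?A x) < e" "dist (?B z') (?B x) < e"
    using z(1) z'(1) sr r by (auto intro!: d1(2) d2(2) simp: add.commute)
  ultimately show False
    by (simp add: e_def dist_real_def abs_if split: if_splits)
qed


subsection \<open>The fundamental group\<close>

lemma loop_homotopy_iff:
  "(p, q) \<in> loop_homotopy X x0 \<longleftrightarrow>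
     homotopic_with (\<lambda>r. r 0 = x0 \<and> r 1 = x0) (top_of_set {0..1}) X p q"
  by (simp add: loop_homotopy_def)

lemma equiv_loop_homotopy: "equiv (loops X x0) (loop_homotopy X x0)"
proof (rule equivI)
  show "loop_homotopy X x0 \<subseteq> loops X x0 \<times> loops X x0"
    by (auto simp: loop_homotopy_def loops_def pathin_def
        dest: homotopic_with_imp_continuous_maps homotopic_with_imp_property)
  show "refl_on (loops X x0) (loop_homotopy X x0)"
    by (auto simp: refl_on_def loop_homotopy_iff loops_def pathin_def)
  show "sym (loop_homotopy X x0)"
    by (auto simp: sym_def loop_homotopy_iff intro: homotopic_with_symD)
  show "trans (loop_homotopy X x0)"
    unfolding trans_def loop_homotopy_iff by (blast intro: homotopic_with_trans)
qed

lemma loop_class_eq: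
  "(p, q) \<in> loop_homotopy X x0 \<Longrightarrow> loop_homotopy X x0 `` {p} = loop_homotopy X x0 `` {q}"
  by (rule equiv_class_eq[OF equiv_loop_homotopy])

lemma loop_homotopy_refl: "p \<in> loops X x0 \<Longrightarrow> (p, p) \<in> loop_homotopy X x0"
  by (auto simp: loop_homotopy_iff loops_def pathin_def)

lemma loop_homotopic_if_eq:
  assumes "p \<in> loops X x0" "\<And>t. t \<in> {0..1} \<Longrightarrow> p t = q t"
  shows "(p, q) \<in> loop_homotopy X x0"
  using assms unfolding loop_homotopy_iff
  by (intro homotopic_with_equal) (auto simp: loops_def pathin_def)

text \<open>The end values of \<open>\<phi>\<close> and \<open>\<psi>\<close> are arbitrary common
  values instead of 0 and 1. This covers the path that runs back and forth along \<open>p\<close>,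
  whose parameter starts and ends at 1.\<close>

lemma loop_homotopy_reparametrize:
  assumes p: "pathin X p"
    and \<phi>: "continuous_on {0..1} \<phi>" "\<phi> ` {0..1} \<subseteq> {0..1}"
    and \<psi>: "continuous_on {0..1} \<psi>" "\<psi> ` {0..1} \<subseteq> {0..1}"
    and ends: "\<phi> 0 = \<psi> 0" "\<phi> 1 = \<psi> 1" "p (\<phi> 0) = x0" "p (\<phi> 1) = x0"
  shows "(p \<circ> \<phi>, p \<circ> \<psi>) \<in> loop_homotopy X x0"
proof -
  let ?I = "top_of_set {0..1::real}"
  let ?h = "\<lambda>(t, x). (1 - t) * \<phi> x + t * \<psi> x"
  have "continuous_on ({0..1} \<times> {0..1}) ?h"
    unfolding split_def
    by (intro continuous_intros continuous_on_compose2[OF \<phi>(1)] continuous_on_compose2[OF \<psi>(1)]) auto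
  moreover have "(1 - t) * \<phi> x + t * \<psi> x \<in> {0..1}" if "t \<in> {0..1}" "x \<in> {0..1}" for t x
  proof -
    have "\<phi> x \<in> {0..1}" "\<psi> x \<in> {0..1}"
      using \<phi>(2) \<psi>(2) that by blast+
    then show ?thesis
      using that convexD_alt[of "{0..1::real}" "\<phi> x" "\<psi> x" t] by simp
  qed
  ultimately have "continuous_map (prod_topology ?I ?I) ?I ?h"
    by (auto simp: prod_topology_subtopology_eu)
  then have "continuous_map (prod_topology ?I ?I) X (p \<circ> ?h)"
    using p unfolding pathin_def by (rule continuous_map_compose)
  then show ?thesis
    unfolding loop_homotopy_iff homotopic_with_def
    using ends by (intro exI[of _ "p \<circ> ?h"]) (auto simp: algebra_simps)
qed

text \<open>The two homotopies are run side by side in the path parameter; they fit together at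
  parameter 1/2, where both rest at the base point.\<close>

lemma loop_concat_homotopic:
  assumes "(p, p') \<in> loop_homotopy X x0" "(q, q') \<in> loop_homotopy X x0"
  shows "(loop_concat p q, loop_concat p' q') \<in> loop_homotopy X x0"
proof -
  let ?I = "top_of_set {0..1::real}"
  let ?X = "prod_topology ?I ?I"
  obtain h where h: "continuous_map ?X X h" "\<And>x. h (0, x) = p x" "\<And>x. h (1, x) = p' x"
    "\<And>t. t \<in> {0..1} \<Longrightarrow> h (t, 0) = x0" "\<And>t. t \<in> {0..1} \<Longrightarrow> h (t, 1) = x0"
    using assms(1) by (auto simp: loop_homotopy_iff homotopic_with_def)
  obtain k where k: "continuous_map ?X X k" "\<And>x. k (0, x) = q x" "\<And>x. k (1, x) = q' x"
    "\<And>t. t \<in> {0..1} \<Longrightarrow> k (t, 0) = x0" "\<And>t. t \<in> {0..1} \<Longrightarrow> k (t, 1) = x0"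
    using assms(2) by (auto simp: loop_homotopy_iff homotopic_with_def)
  let ?a = "\<lambda>y::real \<times> real. (fst y, 2 * snd y)" and ?b = "\<lambda>y::real \<times> real. (fst y, 2 * snd y - 1)"
  define H where "H y = (if snd y \<le> 1 / 2 then (h \<circ> ?a) y else (k \<circ> ?b) y)" for y
  have "continuous_map ?X X H"
    unfolding H_def
  proof (rule continuous_map_cases_le)
    show "continuous_map ?X euclideanreal snd"
      by (simp add: prod_topology_subtopology_eu continuous_on_snd)
    show "continuous_map ?X euclideanreal (\<lambda>x. 1 / 2)" by simp
    show "continuous_map (subtopology ?X {y \<in> topspace ?X. snd y \<le> 1 / 2}) X (h \<circ> ?a)"
      by (rule continuous_map_compose[OF _ h(1)])
        (auto simp: prod_topology_subtopology_eu subtopology_subtopology intro!: continuous_intros)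
    show "continuous_map (subtopology ?X {y \<in> topspace ?X. 1 / 2 \<le> snd y}) X (k \<circ> ?b)"
      by (rule continuous_map_compose[OF _ k(1)])
        (auto simp: prod_topology_subtopology_eu subtopology_subtopology intro!: continuous_intros)
    show "(h \<circ> ?a) y = (k \<circ> ?b) y" if y: "y \<in> topspace ?X" "snd y = 1 / 2" for y
    proof -
      obtain t where "y = (t, 1 / 2)" "t \<in> {0..1}"
        using y by (cases y) auto
      then show ?thesis using h(5) k(4) by simp
    qed
  qed
  moreover have "H (0, x) = loop_concat p q x" "H (1, x) = loop_concat p' q' x" for x
    by (auto simp: H_def loop_concat_def h k)
  moreover have "H (t, 0) = x0" "H (t, 1) = x0" if "t \<in> {0..1}" for t
    using that by (auto simp: H_def h k)
  ultimately show ?thesis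
    unfolding loop_homotopy_iff homotopic_with_def by blast
qed

lemma loops_concat: "p \<in> loops X x0 \<Longrightarrow> q \<in> loops X x0 \<Longrightarrow> loop_concat p q \<in> loops X x0"
  using loop_concat_homotopic[of p p X x0 q q] equiv_loop_homotopy[of X x0]
  by (auto simp: equiv_def loop_homotopy_refl)

lemma carrier_fundamental_group:
  "carrier (fundamental_group X x0) = loops X x0 // loop_homotopy X x0"
  by (simp add: fundamental_group_def)

lemma one_fundamental_group:
  "\<one>\<^bsub>fundamental_group X x0\<^esub> = loop_homotopy X x0 `` {\<lambda>t. x0}"
  by (simp add: fundamental_group_def)

text \<open>The product is a union over all pairs of representatives. All pairs give one and the
  same class, and there is at least one pair, so the union collapses.\<close>

lemma mult_fundamental_group:
  assumes "p \<in> loops X x0" "q \<in> loops X x0"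
  shows "loop_homotopy X x0 `` {p} \<otimes>\<^bsub>fundamental_group X x0\<^esub> loop_homotopy X x0 `` {q}
    = loop_homotopy X x0 `` {loop_concat p q}"
proof -
  let ?L = "loop_homotopy X x0"
  define C where "C = ?L `` {loop_concat p q}"
  have "?L `` {loop_concat p' q'} = C" if "p' \<in> ?L `` {p}" "q' \<in> ?L `` {q}" for p' q'
    using loop_class_eq[OF loop_concat_homotopic, of p p' X x0 q q'] that by (simp add: C_def)
  then have "(\<Union>p'\<in>?L `` {p}. \<Union>q'\<in>?L `` {q}. ?L `` {loop_concat p' q'})
      = (\<Union>p'\<in>?L `` {p}. \<Union>q'\<in>?L `` {q}. C)"
    by (intro SUP_cong refl)
  also have "\<dots> = C"
    using loop_homotopy_refl[OF assms(1)] loop_homotopy_refl[OF assms(2)] by blast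
  finally show ?thesis
    by (simp add: fundamental_group_def C_def)
qed

lemma loop_const: "x0 \<in> topspace X \<Longrightarrow> (\<lambda>t. x0) \<in> loops X x0"
  by (simp add: loops_def)

lemma fundamental_group_elim:
  assumes "A \<in> carrier (fundamental_group X x0)"
  obtains p where "p \<in> loops X x0" "A = loop_homotopy X x0 `` {p}"
  using assms unfolding carrier_fundamental_group by (rule quotientE)

lemma loop_class_in_carrier:
  "p \<in> loops X x0 \<Longrightarrow> loop_homotopy X x0 `` {p} \<in> carrier (fundamental_group X x0)"
  unfolding carrier_fundamental_group by (rule quotientI)

text \<open>Every group law is a reparametrization, and any two reparametrizations with the same end
  points are homotopic since the interval is convex.\<close>

lemma group_fundamental_group:
  assumes "x0 \<in> topspace X"
  shows "group (fundamental_group X x0)"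
proof (rule groupI)
  let ?G = "fundamental_group X x0" and ?L = "loop_homotopy X x0"
  fix A assume "A \<in> carrier ?G"
  then obtain p where p: "p \<in> loops X x0" "A = ?L `` {p}"
    by (rule fundamental_group_elim)
  then have path: "pathin X p" and p01: "p 0 = x0" "p 1 = x0"
    by (auto simp: loops_def)
  \<comment> \<open>This parameter rests at 0 during the first half, so that composing
    \<open>p\<close> with it gives the constant loop followed by \<open>p\<close>.\<close>
  have "(p \<circ> (\<lambda>t. max 0 (2 * t - 1)), p \<circ> (\<lambda>t. t)) \<in> ?L"
    by (rule loop_homotopy_reparametrize[OF path]) (auto intro!: continuous_intros simp: p01)
  moreover have "(p \<circ> (\<lambda>t. max 0 (2 * t - 1))) t = loop_concat (\<lambda>t. x0) p t" for t
    by (cases "t \<le> 1 / 2") (simp_all add: loop_concat_def p01 max_absorb1 max_absorb2)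
  then have "p \<circ> (\<lambda>t. max 0 (2 * t - 1)) = loop_concat (\<lambda>t. x0) p"
    by (rule ext)
  ultimately have "?L `` {loop_concat (\<lambda>t. x0) p} = ?L `` {p}"
    by (simp add: o_def loop_class_eq)
  then show "\<one>\<^bsub>?G\<^esub> \<otimes>\<^bsub>?G\<^esub> A = A"
    by (simp add: one_fundamental_group p mult_fundamental_group loop_const assms)
  have "pathin X (p \<circ> (\<lambda>t. 1 - t))"
    unfolding pathin_def
    by (rule continuous_map_compose[OF _ path[unfolded pathin_def]]) (auto intro!: continuous_intros)
  then have r: "p \<circ> (\<lambda>t. 1 - t) \<in> loops X x0"
    using p01 by (simp add: loops_def)
  \<comment> \<open>The parameter runs from 1 down to 0 and back to 1, which is the reversed loop
    followed by \<open>p\<close>; it is compared with the parameter that stays at 1.\<close>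
  have "(p \<circ> (\<lambda>t. \<bar>2 * t - 1\<bar>), p \<circ> (\<lambda>t. 1)) \<in> ?L"
    by (rule loop_homotopy_reparametrize[OF path]) (auto intro!: continuous_intros simp: p01)
  moreover have "p \<circ> (\<lambda>t. \<bar>2 * t - 1\<bar>) = loop_concat (p \<circ> (\<lambda>t. 1 - t)) p"
    by (auto simp: loop_concat_def fun_eq_iff)
  ultimately have "?L `` {loop_concat (p \<circ> (\<lambda>t. 1 - t)) p} = \<one>\<^bsub>?G\<^esub>"
    by (simp add: o_def loop_class_eq one_fundamental_group p01)
  then have "(?L `` {p \<circ> (\<lambda>t. 1 - t)}) \<otimes>\<^bsub>?G\<^esub> A = \<one>\<^bsub>?G\<^esub>"
    by (simp add: p r mult_fundamental_group del: Image_singleton_iff)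
  then show "\<exists>B\<in>carrier ?G. B \<otimes>\<^bsub>?G\<^esub> A = \<one>\<^bsub>?G\<^esub>"
    using loop_class_in_carrier[OF r] by blast
  fix B assume "B \<in> carrier ?G"
  then obtain q where q: "q \<in> loops X x0" "B = ?L `` {q}"
    by (rule fundamental_group_elim)
  show "A \<otimes>\<^bsub>?G\<^esub> B \<in> carrier ?G"
    by (simp add: p q mult_fundamental_group loop_class_in_carrier loops_concat)
  fix C assume "C \<in> carrier ?G"
  then obtain r where r: "r \<in> loops X x0" "C = ?L `` {r}"
    by (rule fundamental_group_elim)
  let ?k = "loop_concat p (loop_concat q r)"
  \<comment> \<open>Bracketing to the left gives the three loops the intervals [0,1/4], [1/4,1/2],
    [1/2,1]; bracketing to the right gives them [0,1/2], [1/2,3/4], [3/4,1]. The piecewise affine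
    map between these subdivisions has slopes 2, 1, 1/2, hence is concave and equals the minimum of
    its three affine pieces.\<close>
  let ?\<phi> = "\<lambda>t::real. min (2 * t) (min (t + 1 / 4) ((t + 1) / 2))"
  have k: "?k \<in> loops X x0"
    by (simp add: loops_concat p q r)
  have "continuous_on {0..1} ?\<phi>"
    by (intro continuous_intros) auto
  moreover have "?\<phi> ` {0..1} \<subseteq> {0..1}"
    by (auto simp: min_def)
  ultimately have "(?k \<circ> ?\<phi>, ?k \<circ> (\<lambda>t. t)) \<in> ?L"
    using k by (intro loop_homotopy_reparametrize) (auto simp: loops_def)
  moreover have "?k \<circ> ?\<phi> = loop_concat (loop_concat p q) r"
    by (rule ext) (auto simp: loop_concat_def min_def algebra_simps add_divide_distrib)
  ultimately have "?L `` {loop_concat (loop_concat p q) r} = ?L `` {?k}"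
    by (simp add: o_def loop_class_eq)
  then show "A \<otimes>\<^bsub>?G\<^esub> B \<otimes>\<^bsub>?G\<^esub> C = A \<otimes>\<^bsub>?G\<^esub> (B \<otimes>\<^bsub>?G\<^esub> C)"
    by (simp add: p q r mult_fundamental_group loops_concat)
qed (simp add: one_fundamental_group loop_class_in_carrier loop_const assms)

lemma loops_map:
  "continuous_map X Y f \<Longrightarrow> f x0 = y0 \<Longrightarrow> p \<in> loops X x0 \<Longrightarrow> f \<circ> p \<in> loops Y y0"
  by (auto simp: loops_def pathin_def intro: continuous_map_compose)

lemma pi1_map_class:
  assumes f: "continuous_map X Y f" "f x0 = y0" and p: "p \<in> loops X x0"
  shows "pi1_map Y y0 f (loop_homotopy X x0 `` {p}) = loop_homotopy Y y0 `` {f \<circ> p}"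
proof -
  define C where "C = loop_homotopy Y y0 `` {f \<circ> p}"
  have "loop_homotopy Y y0 `` {f \<circ> q} = C" if "q \<in> loop_homotopy X x0 `` {p}" for q
  proof -
    have "homotopic_with (\<lambda>r. r 0 = x0 \<and> r 1 = x0) (top_of_set {0..1}) X p q"
      using that by (simp add: loop_homotopy_iff)
    then have "homotopic_with (\<lambda>r. r 0 = y0 \<and> r 1 = y0) (top_of_set {0..1}) Y (f \<circ> p) (f \<circ> q)"
      by (rule homotopic_with_compose_continuous_map_left[OF _ f(1)]) (auto simp: f(2))
    then show ?thesis
      using loop_class_eq[of "f \<circ> p" "f \<circ> q" Y y0] by (simp add: loop_homotopy_iff C_def)
  qed
  then have "pi1_map Y y0 f (loop_homotopy X x0 `` {p}) = (\<Union>q\<in>loop_homotopy X x0 `` {p}. C)"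
    unfolding pi1_map_def by (intro SUP_cong refl)
  also have "\<dots> = C"
    using loop_homotopy_refl[OF p] by blast
  finally show ?thesis
    by (simp add: C_def)
qed

lemma pi1_map_hom:
  assumes f: "continuous_map X Y f" "f x0 = y0"
  shows "pi1_map Y y0 f \<in> hom (fundamental_group X x0) (fundamental_group Y y0)"
proof (rule homI)
  fix A assume "A \<in> carrier (fundamental_group X x0)"
  then obtain p where p: "p \<in> loops X x0" "A = loop_homotopy X x0 `` {p}"
    by (rule fundamental_group_elim)
  show "pi1_map Y y0 f A \<in> carrier (fundamental_group Y y0)"
    by (simp add: p pi1_map_class[OF f] loop_class_in_carrier loops_map[OF f])
  fix B assume "B \<in> carrier (fundamental_group X x0)"
  then obtain q where q: "q \<in> loops X x0" "B = loop_homotopy X x0 `` {q}"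
    by (rule fundamental_group_elim)
  have "f \<circ> loop_concat p q = loop_concat (f \<circ> p) (f \<circ> q)"
    by (auto simp: loop_concat_def)
  then show "pi1_map Y y0 f (A \<otimes>\<^bsub>fundamental_group X x0\<^esub> B)
      = pi1_map Y y0 f A \<otimes>\<^bsub>fundamental_group Y y0\<^esub> pi1_map Y y0 f B"
    by (simp add: p q pi1_map_class[OF f] mult_fundamental_group loops_concat loops_map[OF f])
qed

text \<open>Maps of collapsed spaces are controlled on the space only, so \<open>h\<close> and
  \<open>g \<circ> f\<close> are compared there. The resulting loops then agree on the unit interval
  but perhaps not as functions on the reals, and are identified through their homotopy
  classes.\<close>

lemma pi1_map_comp:
  assumes f: "continuous_map X Y f" "f x0 = y0" and g: "continuous_map Y Z g" "g y0 = z0"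
    and h: "\<And>x. x \<in> topspace X \<Longrightarrow> h x = g (f x)"
    and A: "A \<in> carrier (fundamental_group X x0)" and x0: "x0 \<in> topspace X"
  shows "pi1_map Z z0 g (pi1_map Y y0 f A) = pi1_map Z z0 h A"
proof -
  obtain p where p: "p \<in> loops X x0" "A = loop_homotopy X x0 `` {p}"
    using A by (rule fundamental_group_elim)
  have "continuous_map X Z h"
    using continuous_map_eq[OF continuous_map_compose[OF f(1) g(1)]] h by simp
  moreover have "h x0 = z0" using h x0 f(2) g(2) by simp
  ultimately have "pi1_map Z z0 h A = loop_homotopy Z z0 `` {h \<circ> p}"
    by (simp add: p pi1_map_class)
  also have "\<dots> = loop_homotopy Z z0 `` {g \<circ> (f \<circ> p)}"
  proof (rule loop_class_eq[OF loop_homotopic_if_eq])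
    show "h \<circ> p \<in> loops Z z0"
      using \<open>continuous_map X Z h\<close> \<open>h x0 = z0\<close> p(1) by (rule loops_map)
    show "(h \<circ> p) t = (g \<circ> (f \<circ> p)) t" if "t \<in> {0..1}" for t
      using p(1) h that path_image_subset_topspace[of X p] by (simp add: loops_def Pi_iff)
  qed
  finally show ?thesis
    by (simp add: p pi1_map_class[OF f] pi1_map_class[OF g] loops_map[OF f])
qed


subsection \<open>Maps of collapsed spaces and limit groups\<close>

lemma collapse_in_topspace: "x \<in> topspace X \<Longrightarrow> collapse X f h x \<in> topspace (collapsed X f h)"
  by (simp add: topspace_collapsed)

lemma sublevel_in_topspace: "sublevel X f h \<in> topspace (collapsed X f h)"
  by (simp add: topspace_collapsed)

text \<open>The universal property of the quotient. The base point needs its own condition because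
  an empty sublevel is a point of \<open>collapsed X f h\<close> that is not hit by
  \<open>collapse\<close>.\<close>

lemma continuous_map_from_collapsed:
  assumes "g (sublevel X f h) \<in> topspace Y"
    and "continuous_map X Y (\<lambda>x. g (collapse X f h x))"
  shows "continuous_map (collapsed X f h) Y g"
  unfolding continuous_map_def
proof (intro conjI allI impI)
  show "g \<in> topspace (collapsed X f h) \<rightarrow> topspace Y"
    using assms by (auto simp: topspace_collapsed continuous_map_def)
  fix W assume W: "openin Y W"
  have "{x \<in> topspace X. collapse X f h x \<in> {A \<in> topspace (collapsed X f h). g A \<in> W}}
      = {x \<in> topspace X. g (collapse X f h x) \<in> W}"
    by (auto simp: collapse_in_topspace)
  then show "openin (collapsed X f h) {A \<in> topspace (collapsed X f h). g A \<in> W}"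
    using openin_continuous_map_preimage[OF assms(2) W]
    unfolding openin_collapsed by (auto simp: topspace_collapsed)
qed

lemma continuous_map_collapse: "continuous_map X (collapsed X f h) (collapse X f h)"
  by (auto simp: continuous_map_def openin_collapsed collapse_in_topspace)

definition sublevel_map ::
  "'a topology \<Rightarrow> ('a \<Rightarrow> real) \<Rightarrow> real \<Rightarrow> 'b topology \<Rightarrow> ('b \<Rightarrow> real) \<Rightarrow> real \<Rightarrow> ('a \<Rightarrow> 'b) \<Rightarrow> bool" where
  "sublevel_map X f h X' f' h' \<phi> \<longleftrightarrow>
     continuous_map X X' \<phi> \<and> (\<forall>x\<in>topspace X. f x \<le> h \<longrightarrow> f' (\<phi> x) \<le> h')"

lemma sublevel_map_in_topspace:
  "sublevel_map X f h X' f' h' \<phi> \<Longrightarrow> x \<in> topspace X \<Longrightarrow> \<phi> x \<in> topspace X'"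
  by (auto simp: sublevel_map_def continuous_map_def)

lemma collapsed_map_sublevel: "collapsed_map X f h X' f' h' \<phi> (sublevel X f h) = sublevel X' f' h'"
  by (simp add: collapsed_map_def)

text \<open>The case distinction in \<open>collapsed_map\<close> is on the point of the quotient.
  For \<open>x\<close> outside the sublevel, the singleton of \<open>x\<close> cannot be the
  sublevel, so the second case applies and recovers \<open>x\<close>; inside, both sides are the
  base point because \<open>\<phi>\<close> respects the sublevels.\<close>

lemma collapsed_map_collapse:
  assumes "sublevel_map X f h X' f' h' \<phi>" "x \<in> topspace X"
  shows "collapsed_map X f h X' f' h' \<phi> (collapse X f h x) = collapse X' f' h' (\<phi> x)"
  using assms by (auto simp: collapsed_map_def collapse_def sublevel_map_def sublevel_def)

lemma continuous_map_collapsed_map: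
  assumes "sublevel_map X f h X' f' h' \<phi>"
  shows "continuous_map (collapsed X f h) (collapsed X' f' h') (collapsed_map X f h X' f' h' \<phi>)"
proof (rule continuous_map_from_collapsed)
  show "collapsed_map X f h X' f' h' \<phi> (sublevel X f h) \<in> topspace (collapsed X' f' h')"
    by (simp add: collapsed_map_sublevel sublevel_in_topspace)
  have "continuous_map X (collapsed X' f' h') (collapse X' f' h' \<circ> \<phi>)"
    using assms continuous_map_collapse unfolding sublevel_map_def
    by (blast intro: continuous_map_compose)
  then show "continuous_map X (collapsed X' f' h')
      (\<lambda>x. collapsed_map X f h X' f' h' \<phi> (collapse X f h x))"
    by (rule continuous_map_eq) (simp add: collapsed_map_collapse[OF assms])
qed

lemma group_pi1_level: "group (pi1_level X f h)"
  unfolding pi1_level_def by (intro group_fundamental_group sublevel_in_topspace)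

lemma level_map_hom:
  "sublevel_map X f h X' f' h' \<phi> \<Longrightarrow>
     level_map X f h X' f' h' \<phi> \<in> hom (pi1_level X f h) (pi1_level X' f' h')"
  unfolding level_map_def pi1_level_def
  by (intro pi1_map_hom continuous_map_collapsed_map collapsed_map_sublevel)

lemma level_map_closed:
  "sublevel_map X f h X' f' h' \<phi> \<Longrightarrow> A \<in> carrier (pi1_level X f h) \<Longrightarrow>
     level_map X f h X' f' h' \<phi> A \<in> carrier (pi1_level X' f' h')"
  using level_map_hom by (rule hom_in_carrier)

lemma level_map_comp:
  assumes \<phi>: "sublevel_map X f h X' f' h' \<phi>" and \<psi>: "sublevel_map X' f' h' X'' f'' h'' \<psi>"
    and \<xi>: "\<And>x. x \<in> topspace X \<Longrightarrow> \<xi> x = \<psi> (\<phi> x)"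
    and A: "A \<in> carrier (pi1_level X f h)"
  shows "level_map X' f' h' X'' f'' h'' \<psi> (level_map X f h X' f' h' \<phi> A)
    = level_map X f h X'' f'' h'' \<xi> A"
  unfolding level_map_def
proof (rule pi1_map_comp)
  have "continuous_map X X'' (\<psi> \<circ> \<phi>)"
    using \<phi> \<psi> by (auto simp: sublevel_map_def intro: continuous_map_compose)
  then have "continuous_map X X'' \<xi>"
    by (rule continuous_map_eq) (simp add: \<xi>)
  then have \<xi>': "sublevel_map X f h X'' f'' h'' \<xi>"
    using \<phi> \<psi> \<xi> sublevel_map_in_topspace[OF \<phi>] by (auto simp: sublevel_map_def)
  show "collapsed_map X f h X'' f'' h'' \<xi> B
      = collapsed_map X' f' h' X'' f'' h'' \<psi> (collapsed_map X f h X' f' h' \<phi> B)"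
    if "B \<in> topspace (collapsed X f h)" for B
    using that sublevel_map_in_topspace[OF \<phi>] unfolding topspace_collapsed
    by (auto simp: collapsed_map_sublevel collapsed_map_collapse[OF \<phi>]
        collapsed_map_collapse[OF \<psi>] collapsed_map_collapse[OF \<xi>'] \<xi>)
  show "A \<in> carrier (fundamental_group (collapsed X f h) (sublevel X f h))"
    using A by (simp add: pi1_level_def)
qed (intro continuous_map_collapsed_map \<phi> \<psi> collapsed_map_sublevel sublevel_in_topspace)+

lemma sublevel_map_mono: "h \<le> h' \<Longrightarrow> sublevel_map X f h X f h' (\<lambda>x. x)"
  by (auto simp: sublevel_map_def)

lemma sublevel_map_bounded:
  "\<forall>x\<in>topspace X. \<bar>f x - f' x\<bar> \<le> K \<Longrightarrow> sublevel_map X f (h - K) X f' h (\<lambda>x. x)"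
  by (fastforce simp: sublevel_map_def)

text \<open>Both the limit over the levels and the common group of all primitives have this form.\<close>

lemma group_compatible_families:
  assumes G: "\<And>i. i \<in> I \<Longrightarrow> group (G i)"
    and R: "\<And>i j \<theta>. (i, j, \<theta>) \<in> R \<Longrightarrow> i \<in> I \<and> j \<in> I \<and> \<theta> \<in> hom (G i) (G j)"
  shows "group (product_group I G
    \<lparr>carrier := {g \<in> (\<Pi>\<^sub>E i\<in>I. carrier (G i)). \<forall>(i, j, \<theta>)\<in>R. \<theta> (g i) = g j}\<rparr>)"
    (is "group (_\<lparr>carrier := ?H\<rparr>)")
proof (rule group.subgroup_imp_group)
  show gp: "group (product_group I G)"
    using G by (rule product_group)
  show "subgroup ?H (product_group I G)"
  proof (rule group.subgroupI[OF gp])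
    show "?H \<subseteq> carrier (product_group I G)" by auto
    have "(\<lambda>i\<in>I. \<one>\<^bsub>G i\<^esub>) \<in> ?H"
      using G R by (auto simp: group.is_monoid monoid.one_closed dest!: R intro!: hom_one)
    then show "?H \<noteq> {}" by blast
    fix g assume g: "g \<in> ?H"
    have "\<theta> (inv\<^bsub>G i\<^esub> g i) = inv\<^bsub>G j\<^esub> g j" if "(i, j, \<theta>) \<in> R" for i j \<theta>
    proof -
      have "group_hom (G i) (G j) \<theta>"
        using G R[OF that] by (simp add: group_hom_def group_hom_axioms_def)
      moreover have "g i \<in> carrier (G i)" "\<theta> (g i) = g j"
        using g R[OF that] that by auto
      ultimately show ?thesis
        by (metis group_hom.hom_inv)
    qed
    then show "inv\<^bsub>product_group I G\<^esub> g \<in> ?H"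
      using g G R by (auto simp: inv_product_group PiE_mem intro!: group.inv_closed)
    fix g' assume g': "g' \<in> ?H"
    have "\<theta> (g i \<otimes>\<^bsub>G i\<^esub> g' i) = g j \<otimes>\<^bsub>G j\<^esub> g' j" if "(i, j, \<theta>) \<in> R" for i j \<theta>
    proof -
      have "g i \<in> carrier (G i)" "\<theta> (g i) = g j" "g' i \<in> carrier (G i)" "\<theta> (g' i) = g' j"
        using g g' R[OF that] that by auto
      then show ?thesis
        using R[OF that] hom_mult[of \<theta> "G i" "G j" "g i" "g' i"] by simp
    qed
    then show "g \<otimes>\<^bsub>product_group I G\<^esub> g' \<in> ?H"
      using g g' G by (auto simp: PiE_mem dest: R intro!: monoid.m_closed group.is_monoid)
  qed
qed

lemma carrier_pi1_limit:
  "carrier (pi1_limit X f) = {g. (\<forall>h. g h \<in> carrier (pi1_level X f h)) \<and>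
     (\<forall>h h'. h < h' \<longrightarrow> zeta X f h h' (g h) = g h')}"
  by (simp add: pi1_limit_def)

lemma mult_pi1_limit: "(g \<otimes>\<^bsub>pi1_limit X f\<^esub> g') = (\<lambda>h. g h \<otimes>\<^bsub>pi1_level X f h\<^esub> g' h)"
  by (simp add: pi1_limit_def restrict_UNIV)

lemma group_pi1_limit: "group (pi1_limit X f)"
proof -
  let ?R = "{(h, h', zeta X f h h') | h h'. h < h'}"
  have "group (product_group UNIV (pi1_level X f) \<lparr>carrier :=
      {g \<in> (\<Pi>\<^sub>E h\<in>UNIV. carrier (pi1_level X f h)). \<forall>(h, h', \<theta>)\<in>?R. \<theta> (g h) = g h'}\<rparr>)"
    by (rule group_compatible_families)
      (auto simp: group_pi1_level intro!: level_map_hom sublevel_map_mono)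
  moreover have "{g \<in> (\<Pi>\<^sub>E h\<in>UNIV. carrier (pi1_level X f h)). \<forall>(h, h', \<theta>)\<in>?R. \<theta> (g h) = g h'}
      = carrier (pi1_limit X f)"
    unfolding carrier_pi1_limit by (auto simp: PiE_UNIV_domain Pi_iff)
  ultimately show ?thesis
    by (simp add: pi1_limit_def)
qed

text \<open>The comparison maps (\<open>r = K\<close>), the deck action (\<open>r = u \<tau>\<close>) and the induced maps (\<open>r = 0\<close>) are
  all of this form, so that every identity between them is an instance of \<open>limit_map_comp\<close>.\<close>

definition limit_map ::
  "'a topology \<Rightarrow> ('a \<Rightarrow> real) \<Rightarrow> 'b topology \<Rightarrow> ('b \<Rightarrow> real) \<Rightarrow> real \<Rightarrow> ('a \<Rightarrow> 'b)
     \<Rightarrow> (real \<Rightarrow> (real \<Rightarrow> 'a set) set) \<Rightarrow> (real \<Rightarrow> (real \<Rightarrow> 'b set) set)" where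
  "limit_map X f X' f' r \<phi> g = (\<lambda>h. level_map X f (h - r) X' f' h \<phi> (g (h - r)))"

text \<open>Compatibility with \<open>zeta\<close> holds because moving up from \<open>h\<close> to
  \<open>h'\<close> before or after applying \<open>\<phi>\<close> gives the same map, the one
  induced by \<open>\<phi>\<close> from level \<open>h - r\<close> to level
  \<open>h'\<close>.\<close>

lemma limit_map_hom:
  assumes \<phi>: "\<And>h. sublevel_map X f (h - r) X' f' h \<phi>"
  shows "limit_map X f X' f' r \<phi> \<in> hom (pi1_limit X f) (pi1_limit X' f')"
proof (rule homI)
  fix g assume g: "g \<in> carrier (pi1_limit X f)"
  then have gh: "g h \<in> carrier (pi1_level X f h)" for h
    by (simp add: carrier_pi1_limit)
  have "zeta X' f' h h' (level_map X f (h - r) X' f' h \<phi> (g (h - r)))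
      = level_map X f (h' - r) X' f' h' \<phi> (g (h' - r))" if "h < h'" for h h'
  proof -
    have "zeta X' f' h h' (level_map X f (h - r) X' f' h \<phi> (g (h - r)))
        = level_map X f (h - r) X' f' h' \<phi> (g (h - r))"
      using that gh by (intro level_map_comp[OF \<phi>] sublevel_map_mono) auto
    also have "\<dots> = level_map X f (h' - r) X' f' h' \<phi> (zeta X f (h - r) (h' - r) (g (h - r)))"
      using that gh by (intro level_map_comp[OF _ \<phi>, symmetric] sublevel_map_mono) auto
    also have "zeta X f (h - r) (h' - r) (g (h - r)) = g (h' - r)"
      using g that by (simp add: carrier_pi1_limit)
    finally show ?thesis .
  qed
  then show "limit_map X f X' f' r \<phi> g \<in> carrier (pi1_limit X' f')"
    by (simp add: carrier_pi1_limit limit_map_def level_map_closed[OF \<phi>] gh)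
  fix g' assume "g' \<in> carrier (pi1_limit X f)"
  then have "g' h \<in> carrier (pi1_level X f h)" for h
    by (simp add: carrier_pi1_limit)
  with gh show "limit_map X f X' f' r \<phi> (g \<otimes>\<^bsub>pi1_limit X f\<^esub> g')
      = limit_map X f X' f' r \<phi> g \<otimes>\<^bsub>pi1_limit X' f'\<^esub> limit_map X f X' f' r \<phi> g'"
    by (simp add: mult_pi1_limit limit_map_def hom_mult[OF level_map_hom[OF \<phi>]])
qed

text \<open>The composite has a name \<open>\<xi>\<close> of its own that is pinned down on
  \<open>X\<close> only. In this way \<open>\<phi>t \<circ> \<tau>\<close> and
  \<open>\<sigma> \<circ> \<phi>t\<close>, which agree just on the covering space, count as the same
  map.\<close>

lemma limit_map_comp:
  assumes \<phi>: "\<And>h. sublevel_map X f (h - r) X' f' h \<phi>" and \<psi>: "\<And>h. sublevel_map X' f' (h - s) X'' f'' h \<psi>"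
    and \<xi>: "\<And>x. x \<in> topspace X \<Longrightarrow> \<xi> x = \<psi> (\<phi> x)"
    and g: "g \<in> carrier (pi1_limit X f)"
  shows "limit_map X' f' X'' f'' s \<psi> (limit_map X f X' f' r \<phi> g) = limit_map X f X'' f'' (r + s) \<xi> g"
proof
  fix h
  have "sublevel_map X f (h - (r + s)) X' f' (h - s) \<phi>"
    using \<phi>[of "h - s"] by (simp add: algebra_simps)
  from level_map_comp[OF this \<psi>, OF \<xi>, of "g (h - (r + s))"]
  show "limit_map X' f' X'' f'' s \<psi> (limit_map X f X' f' r \<phi> g) h
      = limit_map X f X'' f'' (r + s) \<xi> g h"
    using g by (simp add: limit_map_def carrier_pi1_limit algebra_simps)
qed

lemma comparison_eq_limit_map: "comparison X f f' K = limit_map X f X f' K (\<lambda>x. x)"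
  by (simp add: fun_eq_iff comparison_def limit_map_def)


section \<open>Local facts about derivatives and smoothness for computations in charts\<close>

lemma frechet_derivative_cong_open:
  assumes "open S" "x \<in> S" "\<And>z. z \<in> S \<Longrightarrow> f z = g z"
  shows "frechet_derivative f (at x) = frechet_derivative g (at x)"
proof -
  have "(f has_derivative D) (at x) \<longleftrightarrow> (g has_derivative D) (at x)" for D
    using has_derivative_transform_within_open[of f D x UNIV S g]
      has_derivative_transform_within_open[of g D x UNIV S f] assms by auto
  then show ?thesis
    by (simp add: frechet_derivative_def)
qed

text \<open>Two chart expressions can be composed only where the first lands in the domain of the
  second; this set is again open.\<close>

lemma smooth_on_compose_preimage:
  assumes f: "smooth_on S f" and g: "smooth_on T g"
  shows "smooth_on (S \<inter> f -` T) (g \<circ> f)"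
proof -
  have "open (S \<inter> f -` T)"
    using continuous_open_preimage[OF smooth_on_continuous_on[OF f] smooth_on_open[OF f] smooth_on_open[OF g]] .
  then show ?thesis
    using smooth_on_subset[OF f] g by (intro smooth_on_compose[of _ f T]) auto
qed

subsection \<open>Smooth maps and pullbacks of forms\<close>

lemma
  assumes "smooth_manifold M" "\<kappa> \<in> atlas M"
  shows chart_openin: "openin (mtop M) (fst \<kappa>)"
    and chart_image_open: "open (chart_image \<kappa>)"
    and chart_homeomorphic:
      "homeomorphic_map (subtopology (mtop M) (fst \<kappa>)) (top_of_set (chart_image \<kappa>)) (snd \<kappa>)"
  using assms by (auto simp: smooth_manifold_def)

lemma chart_subset: "smooth_manifold M \<Longrightarrow> \<kappa> \<in> atlas M \<Longrightarrow> fst \<kappa> \<subseteq> points M"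
  using chart_openin openin_subset by blast

lemma chart_inj:
  assumes "smooth_manifold M" "\<kappa> \<in> atlas M" shows "inj_on (snd \<kappa>) (fst \<kappa>)"
  using homeomorphic_imp_injective_map[OF chart_homeomorphic[OF assms]] chart_subset[OF assms]
  by (simp add: Int_absorb1 inf.absorb2)

lemma chart_inv_chart:
  "smooth_manifold M \<Longrightarrow> \<kappa> \<in> atlas M \<Longrightarrow> p \<in> fst \<kappa> \<Longrightarrow> chart_inv \<kappa> (snd \<kappa> p) = p"
  unfolding chart_inv_def using chart_inj by (rule inv_into_f_f)

lemma chart_inv_in: "y \<in> chart_image \<kappa> \<Longrightarrow> chart_inv \<kappa> y \<in> fst \<kappa>"
  unfolding chart_inv_def chart_image_def by (rule inv_into_into)

lemma chart_chart_inv: "y \<in> chart_image \<kappa> \<Longrightarrow> snd \<kappa> (chart_inv \<kappa> y) = y"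
  unfolding chart_inv_def chart_image_def by (rule f_inv_into_f)

lemma chart_in_image: "p \<in> fst \<kappa> \<Longrightarrow> snd \<kappa> p \<in> chart_image \<kappa>"
  by (simp add: chart_image_def)

lemma chart_inv_in_points:
  "smooth_manifold M \<Longrightarrow> \<kappa> \<in> atlas M \<Longrightarrow> y \<in> chart_image \<kappa> \<Longrightarrow> chart_inv \<kappa> y \<in> points M"
  using chart_inv_in chart_subset by (metis subsetD)

lemma chart_at:
  assumes "smooth_manifold M" "p \<in> points M"
  obtains \<kappa> where "\<kappa> \<in> atlas M" "p \<in> fst \<kappa>"
proof -
  have "p \<in> (\<Union>\<kappa>\<in>atlas M. fst \<kappa>)"
    using assms by (simp add: smooth_manifold_def)
  then show thesis using that by blast
qed

text \<open>Shows that the choice operator in \<open>pullback_form\<close> does select a chart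
  around the image point.\<close>

lemma selected_chart:
  assumes "smooth_manifold M" "p \<in> points M"
  shows "(SOME \<kappa>. \<kappa> \<in> atlas M \<and> p \<in> fst \<kappa>) \<in> atlas M" "p \<in> fst (SOME \<kappa>. \<kappa> \<in> atlas M \<and> p \<in> fst \<kappa>)"
  using someI_ex[of "\<lambda>\<kappa>. \<kappa> \<in> atlas M \<and> p \<in> fst \<kappa>"] chart_at[OF assms] by blast+

lemma smooth_map_in_points: "smooth_map M N \<phi> \<Longrightarrow> p \<in> points M \<Longrightarrow> \<phi> p \<in> points N"
  by (auto simp: smooth_map_def continuous_map_def)

lemma smooth_map_chart:
  "smooth_map M N \<phi> \<Longrightarrow> \<kappa> \<in> atlas M \<Longrightarrow> \<kappa>' \<in> atlas N \<Longrightarrow>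
     smooth_on (snd \<kappa> ` {p \<in> fst \<kappa>. \<phi> p \<in> fst \<kappa>'}) (snd \<kappa>' \<circ> \<phi> \<circ> chart_inv \<kappa>)"
  by (simp add: smooth_map_def)

lemma chart_in_domain:
  "y \<in> chart_image \<kappa> \<Longrightarrow> \<phi> (chart_inv \<kappa> y) \<in> fst \<kappa>' \<Longrightarrow> y \<in> snd \<kappa> ` {p \<in> fst \<kappa>. \<phi> p \<in> fst \<kappa>'}"
  by (rule image_eqI[of _ _ "chart_inv \<kappa> y"]) (simp_all add: chart_inv_in chart_chart_inv)

text \<open>A chart expression of the composite is factored, near a given point, through a chart
  \<open>\<kappa>'\<close> of \<open>N\<close> around its image under \<open>\<phi>\<close>.
  Injectivity of \<open>\<kappa>'\<close> ensures that the set on which the two factors compose lies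
  in the domain of the expression of the composite.\<close>

lemma smooth_map_compose:
  assumes M: "smooth_manifold M" and N: "smooth_manifold N"
    and \<phi>: "smooth_map M N \<phi>" and \<psi>: "smooth_map N P \<psi>"
  shows "smooth_map M P (\<psi> \<circ> \<phi>)"
  unfolding smooth_map_def
proof (intro conjI ballI)
  show "continuous_map (mtop M) (mtop P) (\<psi> \<circ> \<phi>)"
    using \<phi> \<psi> by (auto simp: smooth_map_def intro: continuous_map_compose)
  fix \<kappa> \<kappa>'' assume \<kappa>: "\<kappa> \<in> atlas M" and \<kappa>'': "\<kappa>'' \<in> atlas P"
  show "smooth_on (snd \<kappa> ` {p \<in> fst \<kappa>. (\<psi> \<circ> \<phi>) p \<in> fst \<kappa>''}) (snd \<kappa>'' \<circ> (\<psi> \<circ> \<phi>) \<circ> chart_inv \<kappa>)"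
    (is "smooth_on ?S ?h")
  proof (rule smooth_on_local)
    fix y assume "y \<in> ?S"
    then obtain p where p: "p \<in> fst \<kappa>" "\<psi> (\<phi> p) \<in> fst \<kappa>''" "y = snd \<kappa> p"
      by auto
    obtain \<kappa>' where \<kappa>': "\<kappa>' \<in> atlas N" "\<phi> p \<in> fst \<kappa>'"
      using chart_at[OF N] smooth_map_in_points[OF \<phi>] chart_subset[OF M \<kappa>] p(1) by blast
    let ?f = "snd \<kappa>' \<circ> \<phi> \<circ> chart_inv \<kappa>" and ?g = "snd \<kappa>'' \<circ> \<psi> \<circ> chart_inv \<kappa>'"
    let ?A = "snd \<kappa> ` {p \<in> fst \<kappa>. \<phi> p \<in> fst \<kappa>'}" and ?B = "snd \<kappa>' ` {q \<in> fst \<kappa>'. \<psi> q \<in> fst \<kappa>''}"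
    note inv = chart_inv_chart[OF M \<kappa>] chart_inv_chart[OF N \<kappa>'(1)]
    have "smooth_on (?A \<inter> ?f -` ?B) (?g \<circ> ?f)"
      using smooth_map_chart[OF \<phi> \<kappa> \<kappa>'(1)] smooth_map_chart[OF \<psi> \<kappa>'(1) \<kappa>'']
      by (rule smooth_on_compose_preimage)
    then have "smooth_on (?A \<inter> ?f -` ?B) ?h"
      by (rule smooth_on_cong) (auto simp: inv dest!: inj_onD[OF chart_inj[OF N \<kappa>'(1)]])
    moreover have "y \<in> ?A \<inter> ?f -` ?B"
      using p \<kappa>'(2) by (auto simp: inv)
    moreover have "?A \<inter> ?f -` ?B \<subseteq> ?S"
    proof
      fix z assume "z \<in> ?A \<inter> ?f -` ?B"
      then obtain a b where ab: "a \<in> fst \<kappa>" "\<phi> a \<in> fst \<kappa>'" "z = snd \<kappa> a"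
        "snd \<kappa>' (\<phi> a) = snd \<kappa>' b" "b \<in> fst \<kappa>'" "\<psi> b \<in> fst \<kappa>''"
        by (auto simp: inv)
      then have "\<phi> a = b"
        using chart_inj[OF N \<kappa>'(1)] by (auto dest: inj_onD)
      then show "z \<in> ?S" using ab by auto
    qed
    ultimately show "\<exists>U. y \<in> U \<and> U \<subseteq> ?S \<and> smooth_on U ?h" by (intro exI conjI)
  qed
qed

lemma smooth_fun_chart:
  "smooth_fun M f \<Longrightarrow> \<kappa> \<in> atlas M \<Longrightarrow> smooth_on (chart_image \<kappa>) (f \<circ> chart_inv \<kappa>)"
  by (simp add: smooth_fun_def)

lemma smooth_fun_compose:
  assumes M: "smooth_manifold M" and N: "smooth_manifold N"
    and \<phi>: "smooth_map M N \<phi>" and f: "smooth_fun N f"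
  shows "smooth_fun M (f \<circ> \<phi>)"
  unfolding smooth_fun_def
proof (intro ballI smooth_on_local)
  fix \<kappa> y assume \<kappa>: "\<kappa> \<in> atlas M" and y: "y \<in> chart_image \<kappa>"
  obtain \<kappa>' where \<kappa>': "\<kappa>' \<in> atlas N" "\<phi> (chart_inv \<kappa> y) \<in> fst \<kappa>'"
    using chart_at[OF N] smooth_map_in_points[OF \<phi>] chart_inv_in_points[OF M \<kappa> y] by blast
  let ?S = "snd \<kappa> ` {p \<in> fst \<kappa>. \<phi> p \<in> fst \<kappa>'}"
  note inv = chart_inv_chart[OF M \<kappa>] chart_inv_chart[OF N \<kappa>'(1)]
  have "smooth_on ?S ((f \<circ> chart_inv \<kappa>') \<circ> (snd \<kappa>' \<circ> \<phi> \<circ> chart_inv \<kappa>))"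
    by (rule smooth_on_compose[OF smooth_map_chart[OF \<phi> \<kappa> \<kappa>'(1)] smooth_fun_chart[OF f \<kappa>'(1)]])
      (auto simp: inv chart_in_image)
  then have "smooth_on ?S (f \<circ> \<phi> \<circ> chart_inv \<kappa>)"
    by (rule smooth_on_cong) (auto simp: inv)
  moreover have "y \<in> ?S" using y \<kappa>'(2) by (rule chart_in_domain)
  moreover have "?S \<subseteq> chart_image \<kappa>" by (auto simp: chart_image_def)
  ultimately show "\<exists>U. y \<in> U \<and> U \<subseteq> chart_image \<kappa> \<and> smooth_on U (f \<circ> \<phi> \<circ> chart_inv \<kappa>)"
    by (intro exI conjI)
qed

lemma smooth_fun_cong:
  assumes "smooth_manifold M" "smooth_fun M f" "\<And>x. x \<in> points M \<Longrightarrow> f x = g x"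
  shows "smooth_fun M g"
  unfolding smooth_fun_def
proof
  fix \<kappa> assume \<kappa>: "\<kappa> \<in> atlas M"
  show "smooth_on (chart_image \<kappa>) (g \<circ> chart_inv \<kappa>)"
    by (rule smooth_on_cong[OF smooth_fun_chart[OF assms(2) \<kappa>]])
      (simp add: assms(3) chart_inv_in_points[OF assms(1) \<kappa>])
qed

lemma smooth_fun_diff: "smooth_fun M f \<Longrightarrow> smooth_fun M g \<Longrightarrow> smooth_fun M (\<lambda>x. f x - g x)"
  by (auto simp: smooth_fun_def o_def intro: smooth_on_diff)

lemma smooth_fun_const: "smooth_manifold M \<Longrightarrow> smooth_fun M (\<lambda>x. c)"
  by (simp add: smooth_fun_def o_def smooth_on_const chart_image_open)

lemma differential_cong:
  assumes M: "smooth_manifold M" and "\<And>x. x \<in> points M \<Longrightarrow> f x = g x"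
  shows "differential M f = differential M g"
proof -
  have "frechet_derivative (f \<circ> chart_inv \<kappa>) (at y) = frechet_derivative (g \<circ> chart_inv \<kappa>) (at y)"
    if "\<kappa> \<in> atlas M" "y \<in> chart_image \<kappa>" for \<kappa> y
    using that chart_image_open[OF M] chart_inv_in_points[OF M] assms(2)
    by (intro frechet_derivative_cong_open[of "chart_image \<kappa>"]) auto
  then show ?thesis by (auto simp: differential_def fun_eq_iff)
qed

lemma differential_diff:
  assumes "smooth_fun M f" "smooth_fun M g"
  shows "differential M (\<lambda>x. f x - g x) = (\<lambda>\<kappa> y v. differential M f \<kappa> y v - differential M g \<kappa> y v)"
proof -
  have "frechet_derivative ((\<lambda>x. f x - g x) \<circ> chart_inv \<kappa>) (at y) v
      = frechet_derivative (f \<circ> chart_inv \<kappa>) (at y) v - frechet_derivative (g \<circ> chart_inv \<kappa>) (at y) v"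
    if "\<kappa> \<in> atlas M" "y \<in> chart_image \<kappa>" for \<kappa> y v
  proof -
    have "f \<circ> chart_inv \<kappa> differentiable (at y)" "g \<circ> chart_inv \<kappa> differentiable (at y)"
      using assms that by (auto intro: smooth_on_differentiable smooth_fun_chart)
    then have "((\<lambda>x. (f \<circ> chart_inv \<kappa>) x - (g \<circ> chart_inv \<kappa>) x) has_derivative
       (\<lambda>v. frechet_derivative (f \<circ> chart_inv \<kappa>) (at y) v - frechet_derivative (g \<circ> chart_inv \<kappa>) (at y) v)) (at y)"
      unfolding frechet_derivative_works by (rule has_derivative_diff)
    from frechet_derivative_at[OF this] show ?thesis
      by (simp add: o_def fun_eq_iff)
  qed
  then show ?thesis by (auto simp: differential_def fun_eq_iff)
qed

lemma differential_const: "differential M (\<lambda>x. c) = (\<lambda>\<kappa> y v. 0)"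
  by (simp add: differential_def o_def fun_eq_iff)

text \<open>The chain rule. It is established for an arbitrary chart \<open>\<kappa>'\<close> around
  the image point, hence also for the one selected in \<open>pullback_form\<close>.\<close>

lemma pullback_differential:
  assumes M: "smooth_manifold M" and N: "smooth_manifold N"
    and \<phi>: "smooth_map M N \<phi>" and f: "smooth_fun N f"
  shows "pullback_form M N \<phi> (differential N f) = differential M (f \<circ> \<phi>)"
proof -
  have "differential N f \<kappa>' (snd \<kappa>' (\<phi> (chart_inv \<kappa> y)))
       (frechet_derivative (snd \<kappa>' \<circ> \<phi> \<circ> chart_inv \<kappa>) (at y) v)
     = frechet_derivative (f \<circ> \<phi> \<circ> chart_inv \<kappa>) (at y) v"
    if \<kappa>: "\<kappa> \<in> atlas M" and y: "y \<in> chart_image \<kappa>"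
      and \<kappa>': "\<kappa>' \<in> atlas N" "\<phi> (chart_inv \<kappa> y) \<in> fst \<kappa>'" for \<kappa> y v \<kappa>'
  proof -
    let ?f = "snd \<kappa>' \<circ> \<phi> \<circ> chart_inv \<kappa>" and ?g = "f \<circ> chart_inv \<kappa>'"
    let ?S = "snd \<kappa> ` {p \<in> fst \<kappa>. \<phi> p \<in> fst \<kappa>'}"
    note inv = chart_inv_chart[OF M \<kappa>] chart_inv_chart[OF N \<kappa>'(1)]
    have yS: "y \<in> ?S" using y \<kappa>'(2) by (rule chart_in_domain)
    have fS: "smooth_on ?S ?f" by (rule smooth_map_chart[OF \<phi> \<kappa> \<kappa>'(1)])
    have fy: "?f y \<in> chart_image \<kappa>'" using \<kappa>'(2) by (simp add: chart_in_image)
    have "frechet_derivative (?g \<circ> ?f) (at y) = frechet_derivative ?g (at (?f y)) \<circ> frechet_derivative ?f (at y)"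
      by (rule frechet_derivative_compose[OF smooth_on_differentiable[OF fS yS]
            smooth_on_differentiable[OF smooth_fun_chart[OF f \<kappa>'(1)] fy]])
    moreover have "frechet_derivative (?g \<circ> ?f) (at y) = frechet_derivative (f \<circ> \<phi> \<circ> chart_inv \<kappa>) (at y)"
      by (rule frechet_derivative_cong_open[OF smooth_on_open[OF fS] yS]) (auto simp: inv)
    ultimately show ?thesis
      using \<kappa>' fy by (simp add: differential_def)
  qed
  then show ?thesis
    unfolding pullback_form_def Let_def
    using selected_chart[OF N smooth_map_in_points[OF \<phi> chart_inv_in_points[OF M]]]
    by (auto simp: differential_def[of M] fun_eq_iff)
qed

text \<open>Both sides select their chart around the same point of \<open>P\<close>, so they
  evaluate \<open>\<omega>\<close> in the same chart \<open>\<kappa>''\<close>. What remains is the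
  chain rule through the intermediate chart \<open>\<kappa>'\<close>; no transformation law for
  \<open>\<omega>\<close> enters.\<close>

lemma pullback_compose:
  assumes M: "smooth_manifold M" and N: "smooth_manifold N" and P: "smooth_manifold P"
    and \<phi>: "smooth_map M N \<phi>" and \<psi>: "smooth_map N P \<psi>"
  shows "pullback_form M N \<phi> (pullback_form N P \<psi> \<omega>) = pullback_form M P (\<psi> \<circ> \<phi>) \<omega>"
proof (intro ext)
  fix \<kappa> y v
  show "pullback_form M N \<phi> (pullback_form N P \<psi> \<omega>) \<kappa> y v = pullback_form M P (\<psi> \<circ> \<phi>) \<omega> \<kappa> y v"
  proof (cases "\<kappa> \<in> atlas M \<and> y \<in> chart_image \<kappa>")
    case True
    then have \<kappa>: "\<kappa> \<in> atlas M" and y: "y \<in> chart_image \<kappa>" by auto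
    define q where "q = \<phi> (chart_inv \<kappa> y)"
    have q: "q \<in> points N"
      unfolding q_def using smooth_map_in_points[OF \<phi> chart_inv_in_points[OF M \<kappa> y]] .
    define \<kappa>' where "\<kappa>' = (SOME \<kappa>'. \<kappa>' \<in> atlas N \<and> q \<in> fst \<kappa>')"
    have \<kappa>': "\<kappa>' \<in> atlas N" "q \<in> fst \<kappa>'"
      unfolding \<kappa>'_def using selected_chart[OF N q] .
    define \<kappa>'' where "\<kappa>'' = (SOME \<kappa>''. \<kappa>'' \<in> atlas P \<and> \<psi> q \<in> fst \<kappa>'')"
    have \<kappa>'': "\<kappa>'' \<in> atlas P" "\<psi> q \<in> fst \<kappa>''"
      unfolding \<kappa>''_def using selected_chart[OF P smooth_map_in_points[OF \<psi> q]] .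
    let ?f = "snd \<kappa>' \<circ> \<phi> \<circ> chart_inv \<kappa>" and ?g = "snd \<kappa>'' \<circ> \<psi> \<circ> chart_inv \<kappa>'"
    let ?A = "snd \<kappa> ` {p \<in> fst \<kappa>. \<phi> p \<in> fst \<kappa>'}" and ?B = "snd \<kappa>' ` {q \<in> fst \<kappa>'. \<psi> q \<in> fst \<kappa>''}"
    note inv = chart_inv_chart[OF M \<kappa>] chart_inv_chart[OF N \<kappa>'(1)]
    have yA: "y \<in> ?A" using y \<kappa>'(2) unfolding q_def by (rule chart_in_domain)
    have fA: "smooth_on ?A ?f" by (rule smooth_map_chart[OF \<phi> \<kappa> \<kappa>'(1)])
    have gB: "smooth_on ?B ?g" by (rule smooth_map_chart[OF \<psi> \<kappa>'(1) \<kappa>''(1)])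
    have fy: "?f y = snd \<kappa>' q" by (simp add: q_def)
    have fyB: "?f y \<in> ?B" unfolding fy using \<kappa>'(2) \<kappa>''(2) by blast
    have "frechet_derivative (?g \<circ> ?f) (at y) = frechet_derivative ?g (at (?f y)) \<circ> frechet_derivative ?f (at y)"
      by (rule frechet_derivative_compose[OF smooth_on_differentiable[OF fA yA]
            smooth_on_differentiable[OF gB fyB]])
    moreover have "frechet_derivative (?g \<circ> ?f) (at y)
        = frechet_derivative (snd \<kappa>'' \<circ> (\<psi> \<circ> \<phi>) \<circ> chart_inv \<kappa>) (at y)"
      by (rule frechet_derivative_cong_open[OF smooth_on_open[OF fA] yA]) (auto simp: inv)
    ultimately have D: "frechet_derivative (snd \<kappa>'' \<circ> (\<psi> \<circ> \<phi>) \<circ> chart_inv \<kappa>) (at y) v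
        = frechet_derivative ?g (at (snd \<kappa>' q)) (frechet_derivative ?f (at y) v)"
      by (simp add: q_def)
    have "pullback_form M N \<phi> (pullback_form N P \<psi> \<omega>) \<kappa> y v
        = pullback_form N P \<psi> \<omega> \<kappa>' (snd \<kappa>' q) (frechet_derivative ?f (at y) v)"
      using True by (simp add: pullback_form_def[of M N] Let_def q_def[symmetric] \<kappa>'_def[symmetric])
    also have "\<dots> = \<omega> \<kappa>'' (snd \<kappa>'' (\<psi> q)) (frechet_derivative ?g (at (snd \<kappa>' q)) (frechet_derivative ?f (at y) v))"
      using \<kappa>' by (simp add: pullback_form_def Let_def inv \<kappa>''_def[symmetric] chart_in_image)
    also have "\<dots> = pullback_form M P (\<psi> \<circ> \<phi>) \<omega> \<kappa> y v"
      using True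
      by (simp add: pullback_form_def Let_def q_def[symmetric] \<kappa>''_def[symmetric] D[symmetric])
    finally show ?thesis .
  qed (auto simp: pullback_form_def)
qed

lemma pullback_cong:
  fixes M :: "('a, 'e::euclidean_space) manifold" and N :: "('b, 'f::euclidean_space) manifold"
  assumes M: "smooth_manifold M" and eq: "\<And>x. x \<in> points M \<Longrightarrow> \<phi> x = \<psi> x"
  shows "pullback_form M N \<phi> = pullback_form M N \<psi>"
proof (intro ext)
  fix \<omega> \<kappa> y v
  show "pullback_form M N \<phi> \<omega> \<kappa> y v = pullback_form M N \<psi> \<omega> \<kappa> y v"
  proof (cases "\<kappa> \<in> atlas M \<and> y \<in> chart_image \<kappa>")
    case True
    have eq': "\<phi> (chart_inv \<kappa> z) = \<psi> (chart_inv \<kappa> z)" if "z \<in> chart_image \<kappa>" for z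
      using eq chart_inv_in_points[OF M _ that] True by blast
    have "frechet_derivative (c \<circ> \<phi> \<circ> chart_inv \<kappa>) (at y) = frechet_derivative (c \<circ> \<psi> \<circ> chart_inv \<kappa>) (at y)"
      for c :: "'b \<Rightarrow> 'f"
      using True chart_image_open[OF M] eq'
      by (intro frechet_derivative_cong_open[of "chart_image \<kappa>"]) auto
    then show ?thesis
      using True eq' by (simp add: pullback_form_def Let_def)
  qed (auto simp: pullback_form_def)
qed

lemma pullback_diff:
  "pullback_form M N \<phi> (\<lambda>\<kappa> y v. \<beta> \<kappa> y v - \<alpha> \<kappa> y v)
    = (\<lambda>\<kappa> y v. pullback_form M N \<phi> \<beta> \<kappa> y v - pullback_form M N \<phi> \<alpha> \<kappa> y v)"
  by (intro ext) (simp add: pullback_form_def Let_def)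

section \<open>Exact and closed forms\<close>

lemma exact_zero: "smooth_manifold M \<Longrightarrow> exact_form M (\<lambda>\<kappa> y v. 0)"
  unfolding exact_form_def
  by (intro exI[of _ "\<lambda>x. 0"] conjI smooth_fun_const) (simp_all add: differential_const)

lemma exact_diff:
  assumes "exact_form M \<alpha>" "exact_form M \<beta>" shows "exact_form M (\<lambda>\<kappa> y v. \<alpha> \<kappa> y v - \<beta> \<kappa> y v)"
proof -
  obtain f g where "smooth_fun M f" "\<alpha> = differential M f" "smooth_fun M g" "\<beta> = differential M g"
    using assms by (auto simp: exact_form_def)
  then show ?thesis
    unfolding exact_form_def
    by (intro exI[of _ "\<lambda>x. f x - g x"]) (simp add: smooth_fun_diff differential_diff)
qed

lemma exact_pullback:
  assumes "smooth_manifold M" "smooth_manifold N" "smooth_map M N \<phi>" "exact_form N \<alpha>"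
  shows "exact_form M (pullback_form M N \<phi> \<alpha>)"
proof -
  obtain f where "smooth_fun N f" "\<alpha> = differential N f"
    using assms(4) by (auto simp: exact_form_def)
  then show ?thesis
    unfolding exact_form_def using assms(1-3)
    by (intro exI[of _ "f \<circ> \<phi>"]) (simp add: pullback_differential smooth_fun_compose)
qed

text \<open>In a chart the form is the derivative of the coordinate expression of \<open>f\<close>:
  the chain rule gives the change of charts, and symmetry of second derivatives gives
  closedness.\<close>

lemma exact_imp_closed:
  assumes M: "smooth_manifold M" and "exact_form M \<omega>"
  shows "closed_form M \<omega>"
proof -
  obtain f where f: "smooth_fun M f" and \<omega>: "\<omega> = differential M f"
    using assms(2) by (auto simp: exact_form_def)
  have \<omega>': "\<omega> \<kappa> y v = frechet_derivative (f \<circ> chart_inv \<kappa>) (at y) v"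
    if "\<kappa> \<in> atlas M" "y \<in> chart_image \<kappa>" for \<kappa> y v
    using that by (simp add: \<omega> differential_def)
  have lin: "linear (\<omega> \<kappa> y)" if "\<kappa> \<in> atlas M" "y \<in> chart_image \<kappa>" for \<kappa> y
  proof -
    have "\<omega> \<kappa> y = frechet_derivative (f \<circ> chart_inv \<kappa>) (at y)"
      using \<omega>' that by (simp add: fun_eq_iff)
    then show ?thesis
      using linear_frechet_derivative[OF smooth_on_differentiable[OF smooth_fun_chart[OF f]]] that by simp
  qed
  have smooth: "smooth_on (chart_image \<kappa>) (\<lambda>y. \<omega> \<kappa> y v)" if "\<kappa> \<in> atlas M" for \<kappa> v
    using smooth_on_cong[OF smooth_on_derivative[OF smooth_fun_chart[OF f that], of v]] \<omega>'[OF that] by simp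
  have change: "\<omega> \<kappa> (snd \<kappa> p) v =
      \<omega> \<kappa>' (snd \<kappa>' p) (frechet_derivative (snd \<kappa>' \<circ> chart_inv \<kappa>) (at (snd \<kappa> p)) v)"
    if \<kappa>: "\<kappa> \<in> atlas M" and \<kappa>': "\<kappa>' \<in> atlas M" and p: "p \<in> fst \<kappa> \<inter> fst \<kappa>'" for \<kappa> \<kappa>' p v
  proof -
    let ?S = "snd \<kappa> ` (fst \<kappa> \<inter> fst \<kappa>')" and ?f = "snd \<kappa>' \<circ> chart_inv \<kappa>" and ?g = "f \<circ> chart_inv \<kappa>'"
    note inv = chart_inv_chart[OF M \<kappa>] chart_inv_chart[OF M \<kappa>']
    have fS: "smooth_on ?S ?f"
      using M \<kappa> \<kappa>' by (simp add: smooth_manifold_def)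
    have y: "snd \<kappa> p \<in> ?S" using p by blast
    have fy: "?f (snd \<kappa> p) = snd \<kappa>' p" using p by (simp add: inv)
    then have fy': "?f (snd \<kappa> p) \<in> chart_image \<kappa>'" using p by (simp add: chart_in_image)
    have "frechet_derivative (?g \<circ> ?f) (at (snd \<kappa> p))
        = frechet_derivative ?g (at (?f (snd \<kappa> p))) \<circ> frechet_derivative ?f (at (snd \<kappa> p))"
      by (rule frechet_derivative_compose[OF smooth_on_differentiable[OF fS y]
            smooth_on_differentiable[OF smooth_fun_chart[OF f \<kappa>'] fy']])
    moreover have "frechet_derivative (?g \<circ> ?f) (at (snd \<kappa> p))
        = frechet_derivative (f \<circ> chart_inv \<kappa>) (at (snd \<kappa> p))"
      by (rule frechet_derivative_cong_open[OF smooth_on_open[OF fS] y]) (auto simp: inv)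
    ultimately show ?thesis
      using \<kappa> \<kappa>' p fy by (simp add: \<omega>' chart_in_image)
  qed
  have sym: "frechet_derivative (\<lambda>z. \<omega> \<kappa> z w) (at y) v - frechet_derivative (\<lambda>z. \<omega> \<kappa> z v) (at y) w = 0"
    if \<kappa>: "\<kappa> \<in> atlas M" and y: "y \<in> chart_image \<kappa>" for \<kappa> y v w
  proof -
    have "frechet_derivative (\<lambda>z. \<omega> \<kappa> z v) (at y)
        = frechet_derivative (\<lambda>z. frechet_derivative (f \<circ> chart_inv \<kappa>) (at z) v) (at y)" for v
      by (rule frechet_derivative_cong_open[OF chart_image_open[OF M \<kappa>] y]) (simp add: \<omega>' \<kappa>)
    then show ?thesis
      using symmetric_second_derivative[OF smooth_fun_chart[OF f \<kappa>] y] by simp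
  qed
  have zero: "\<omega> \<kappa> y v = 0" if "\<not> (\<kappa> \<in> atlas M \<and> y \<in> chart_image \<kappa>)" for \<kappa> y v
    using that by (auto simp: \<omega> differential_def)
  show ?thesis
    unfolding closed_form_def one_form_def
    by (intro conjI ballI allI impI; (rule lin smooth change sym zero; assumption))
qed

lemma closed_form_smooth:
  "closed_form M \<omega> \<Longrightarrow> \<kappa> \<in> atlas M \<Longrightarrow> smooth_on (chart_image \<kappa>) (\<lambda>y. \<omega> \<kappa> y v)"
  by (simp add: closed_form_def one_form_def)

lemma closed_form_outside:
  assumes "closed_form M \<omega>" "\<not> (\<kappa> \<in> atlas M \<and> y \<in> chart_image \<kappa>)"
  shows "\<omega> \<kappa> y v = 0"
proof -
  have "\<forall>\<kappa> y v. \<not> (\<kappa> \<in> atlas M \<and> y \<in> chart_image \<kappa>) \<longrightarrow> \<omega> \<kappa> y v = 0"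
    using assms(1) unfolding closed_form_def one_form_def by (elim conjE)
  then show ?thesis using assms(2) by metis
qed

lemma closed_diff:
  assumes M: "smooth_manifold M" and \<alpha>: "closed_form M \<alpha>" and \<beta>: "closed_form M \<beta>"
  shows "closed_form M (\<lambda>\<kappa> y v. \<alpha> \<kappa> y v - \<beta> \<kappa> y v)" (is "closed_form M ?\<omega>")
proof -
  have lin: "linear (?\<omega> \<kappa> y)" if "\<kappa> \<in> atlas M" "y \<in> chart_image \<kappa>" for \<kappa> y
    using \<alpha> \<beta> that by (auto simp: closed_form_def one_form_def intro: linear_compose_sub)
  have smooth: "smooth_on (chart_image \<kappa>) (\<lambda>y. ?\<omega> \<kappa> y v)" if "\<kappa> \<in> atlas M" for \<kappa> v
    using smooth_on_diff[OF closed_form_smooth[OF \<alpha> that] closed_form_smooth[OF \<beta> that]] .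
  have change: "?\<omega> \<kappa> (snd \<kappa> p) v =
      ?\<omega> \<kappa>' (snd \<kappa>' p) (frechet_derivative (snd \<kappa>' \<circ> chart_inv \<kappa>) (at (snd \<kappa> p)) v)"
    if "\<kappa> \<in> atlas M" "\<kappa>' \<in> atlas M" "p \<in> fst \<kappa> \<inter> fst \<kappa>'" for \<kappa> \<kappa>' p v
    using \<alpha> \<beta> that unfolding closed_form_def one_form_def by (metis (no_types, lifting))
  have D: "frechet_derivative (\<lambda>z. ?\<omega> \<kappa> z w) (at y) v
      = frechet_derivative (\<lambda>z. \<alpha> \<kappa> z w) (at y) v - frechet_derivative (\<lambda>z. \<beta> \<kappa> z w) (at y) v"
    if "\<kappa> \<in> atlas M" "y \<in> chart_image \<kappa>" for \<kappa> y v w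
  proof -
    have "(\<lambda>z. \<alpha> \<kappa> z w) differentiable (at y)" "(\<lambda>z. \<beta> \<kappa> z w) differentiable (at y)"
      using smooth_on_differentiable[OF closed_form_smooth[OF \<alpha> that(1)] that(2)]
        smooth_on_differentiable[OF closed_form_smooth[OF \<beta> that(1)] that(2)] .
    from frechet_derivative_at[OF has_derivative_diff[OF this[unfolded frechet_derivative_works]]]
    show ?thesis by (simp add: fun_eq_iff)
  qed
  have sym: "frechet_derivative (\<lambda>z. ?\<omega> \<kappa> z w) (at y) v - frechet_derivative (\<lambda>z. ?\<omega> \<kappa> z v) (at y) w = 0"
    if "\<kappa> \<in> atlas M" "y \<in> chart_image \<kappa>" for \<kappa> y v w
    using \<alpha> \<beta> that by (simp add: D closed_form_def)
  have zero: "?\<omega> \<kappa> y v = 0" if "\<not> (\<kappa> \<in> atlas M \<and> y \<in> chart_image \<kappa>)" for \<kappa> y v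
  proof -
    show ?thesis
      using closed_form_outside[OF \<alpha> that] closed_form_outside[OF \<beta> that] by simp
  qed
  show ?thesis
    unfolding closed_form_def one_form_def
    by (intro conjI ballI allI impI; (rule lin smooth change sym zero; assumption))
qed

section \<open>Cohomology classes and their pullbacks\<close>

lemma H1_elim:
  assumes "u \<in> H1 M"
  obtains \<alpha> where "closed_form M \<alpha>" "u = {\<beta>. closed_form M \<beta> \<and> exact_form M (\<lambda>\<kappa> y v. \<beta> \<kappa> y v - \<alpha> \<kappa> y v)}"
  using assms by (auto simp: H1_def cohomologous_def Image_def elim!: quotientE)

lemma H1_closed: "u \<in> H1 M \<Longrightarrow> \<alpha> \<in> u \<Longrightarrow> closed_form M \<alpha>"
  by (erule H1_elim) auto

lemma H1_exact_diff:
  assumes "u \<in> H1 M" "\<alpha> \<in> u" "\<beta> \<in> u"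
  shows "exact_form M (\<lambda>\<kappa> y v. \<beta> \<kappa> y v - \<alpha> \<kappa> y v)"
proof -
  obtain \<omega> where "closed_form M \<omega>" "u = {\<beta>. closed_form M \<beta> \<and> exact_form M (\<lambda>\<kappa> y v. \<beta> \<kappa> y v - \<omega> \<kappa> y v)}"
    using assms(1) by (rule H1_elim)
  then have "exact_form M (\<lambda>\<kappa> y v. \<beta> \<kappa> y v - \<omega> \<kappa> y v)" "exact_form M (\<lambda>\<kappa> y v. \<alpha> \<kappa> y v - \<omega> \<kappa> y v)"
    using assms(2,3) by auto
  from exact_diff[OF this] show ?thesis by simp
qed

lemma H1_cohomologous:
  "u \<in> H1 M \<Longrightarrow> \<alpha> \<in> u \<Longrightarrow> \<beta> \<in> u \<Longrightarrow> (\<alpha>, \<beta>) \<in> cohomologous M"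
  by (simp add: cohomologous_def H1_closed H1_exact_diff)

lemma H1_nonempty:
  assumes "smooth_manifold M" "u \<in> H1 M" shows "u \<noteq> {}"
  using exact_zero[OF assms(1)] by (rule_tac H1_elim[OF assms(2)]) auto

text \<open>Only closed forms belong to a class. Some representative of \<open>u\<close> has a closed pullback, and
  the pullbacks of the others differ from it by exact forms, which are closed because second
  derivatives are symmetric.\<close>

lemma pullback_in_pullback_class:
  assumes M: "smooth_manifold M" and N: "smooth_manifold N" and \<phi>: "smooth_map M N \<phi>"
    and u: "u \<in> H1 N" "pullback_class M N \<phi> u \<in> H1 M" and \<alpha>: "\<alpha> \<in> u"
  shows "pullback_form M N \<phi> \<alpha> \<in> pullback_class M N \<phi> u"
proof -
  let ?p = "pullback_form M N \<phi>"
  \<comment> \<open>The pulled back class is nonempty, being an element of \<open>H1 M\<close>. A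
    member of it is related by \<open>cohomologous\<close> to the pullback of some
    \<open>\<beta>\<close>, and this relation holds between closed forms only.\<close>
  obtain \<beta> where \<beta>: "\<beta> \<in> u" "closed_form M (?p \<beta>)"
    using H1_nonempty[OF M u(2)] by (auto simp: pullback_class_def cohomologous_def)
  have "closed_form M (?p (\<lambda>\<kappa> y v. \<beta> \<kappa> y v - \<alpha> \<kappa> y v))"
    using H1_exact_diff[OF u(1) \<alpha> \<beta>(1)] by (intro exact_imp_closed[OF M] exact_pullback[OF M N \<phi>])
  from closed_diff[OF M \<beta>(2) this] have "closed_form M (?p \<alpha>)"
    by (simp add: pullback_diff)
  then have "(?p \<alpha>, ?p \<alpha>) \<in> cohomologous M"
    by (simp add: cohomologous_def exact_zero[OF M])
  with \<alpha> show ?thesis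
    by (auto simp: pullback_class_def)
qed

text \<open>The inner class contains forms that are not pullbacks from \<open>P\<close>, so the
  inclusion from right to left is not a matter of representatives. It follows because the right side
  is a single class: each of its members is cohomologous to the pullback of one fixed form in
  \<open>u\<close>.\<close>

lemma pullback_class_compose:
  assumes M: "smooth_manifold M" and N: "smooth_manifold N" and P: "smooth_manifold P"
    and \<phi>: "smooth_map M N \<phi>" and \<psi>: "smooth_map N P \<psi>"
    and u: "u \<in> H1 P" "pullback_class N P \<psi> u \<in> H1 N"
      "pullback_class M N \<phi> (pullback_class N P \<psi> u) \<in> H1 M"
  shows "pullback_class M P (\<psi> \<circ> \<phi>) u = pullback_class M N \<phi> (pullback_class N P \<psi> u)"
    (is "?L = pullback_class M N \<phi> ?u")
proof
  have mem: "pullback_form N P \<psi> \<alpha> \<in> ?u" if "\<alpha> \<in> u" for \<alpha>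
    using pullback_in_pullback_class[OF N P \<psi> u(1,2) that] .
  have comp: "pullback_form M N \<phi> (pullback_form N P \<psi> \<alpha>) = pullback_form M P (\<psi> \<circ> \<phi>) \<alpha>" for \<alpha>
    by (rule pullback_compose[OF M N P \<phi> \<psi>])
  show "?L \<subseteq> pullback_class M N \<phi> ?u"
  proof
    fix \<gamma> assume "\<gamma> \<in> ?L"
    then obtain \<alpha> where "\<alpha> \<in> u" "(pullback_form M P (\<psi> \<circ> \<phi>) \<alpha>, \<gamma>) \<in> cohomologous M"
      by (auto simp: pullback_class_def)
    then have "(pullback_form M N \<phi> (pullback_form N P \<psi> \<alpha>), \<gamma>) \<in> cohomologous M"
      by (simp add: comp)
    with mem[OF \<open>\<alpha> \<in> u\<close>] show "\<gamma> \<in> pullback_class M N \<phi> ?u"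
      unfolding pullback_class_def[of M N] by blast
  qed
  show "pullback_class M N \<phi> ?u \<subseteq> ?L"
  proof
    fix \<gamma> assume \<gamma>: "\<gamma> \<in> pullback_class M N \<phi> ?u"
    obtain \<alpha> where \<alpha>: "\<alpha> \<in> u"
      using H1_nonempty[OF P u(1)] by blast
    have "pullback_form M P (\<psi> \<circ> \<phi>) \<alpha> \<in> pullback_class M N \<phi> ?u"
      using pullback_in_pullback_class[OF M N \<phi> u(2,3) mem[OF \<alpha>]] by (simp add: comp)
    from H1_cohomologous[OF u(3) this \<gamma>] show "\<gamma> \<in> ?L"
      using \<alpha> by (auto simp: pullback_class_def)
  qed
qed


subsection \<open>Morphisms and primitives\<close>

lemma
  assumes "novikov_object C"
  shows novikov_cover: "smooth_manifold (cover C)"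
    and novikov_base: "smooth_manifold (base C)"
    and novikov_proj: "smooth_map (cover C) (base C) (proj C)"
    and novikov_covering: "smooth_covering (cover C) (base C) (proj C)"
    and novikov_connected: "connected_space (mtop (cover C))"
    and novikov_cls: "cls C \<in> H1 (base C)"
  using assms by (auto simp: novikov_object_def closed_manifold_def smooth_covering_def)

lemma
  assumes "novikov_morphism C D \<phi>t \<phi>"
  shows morphism_cover: "smooth_map (cover C) (cover D) \<phi>t"
    and morphism_base: "smooth_map (base C) (base D) \<phi>"
    and morphism_proj: "x \<in> points (cover C) \<Longrightarrow> proj D (\<phi>t x) = \<phi> (proj C x)"
    and morphism_cls: "cls C = pullback_class (base C) (base D) \<phi> (cls D)"
  using assms by (auto simp: novikov_morphism_def)

lemma novikov_morphism_compose:
  assumes C: "novikov_object C" and D: "novikov_object D" and E: "novikov_object E"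
    and \<phi>: "novikov_morphism C D \<phi>t \<phi>" and \<psi>: "novikov_morphism D E \<psi>t \<psi>"
  shows "novikov_morphism C E (\<psi>t \<circ> \<phi>t) (\<psi> \<circ> \<phi>)"
  unfolding novikov_morphism_def
proof (intro conjI ballI)
  show "smooth_map (cover C) (cover E) (\<psi>t \<circ> \<phi>t)"
    using smooth_map_compose[OF novikov_cover[OF C] novikov_cover[OF D] morphism_cover[OF \<phi>] morphism_cover[OF \<psi>]] .
  show "smooth_map (base C) (base E) (\<psi> \<circ> \<phi>)"
    using smooth_map_compose[OF novikov_base[OF C] novikov_base[OF D] morphism_base[OF \<phi>] morphism_base[OF \<psi>]] .
  show "proj E ((\<psi>t \<circ> \<phi>t) x) = (\<psi> \<circ> \<phi>) (proj C x)" if "x \<in> points (cover C)" for x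
    using that smooth_map_in_points[OF morphism_cover[OF \<phi>]]
    by (simp add: morphism_proj[OF \<phi>] morphism_proj[OF \<psi>])
  show "cls C = pullback_class (base C) (base E) (\<psi> \<circ> \<phi>) (cls E)"
    using pullback_class_compose[OF novikov_base[OF C] novikov_base[OF D] novikov_base[OF E]
        morphism_base[OF \<phi>] morphism_base[OF \<psi>] novikov_cls[OF E]]
      novikov_cls[OF D] novikov_cls[OF C] by (simp add: morphism_cls[OF \<phi>] morphism_cls[OF \<psi>])
qed

lemma primitivesE:
  assumes "f \<in> primitives C"
  obtains \<alpha> where "smooth_fun (cover C) f" "\<alpha> \<in> cls C"
    "differential (cover C) f = pullback_form (cover C) (base C) (proj C) \<alpha>"
  using assms by (auto simp: primitives_def)

text \<open>The two ways round the square formed by \<open>\<phi>t\<close>, \<open>\<phi>\<close>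
  and the projections turn the pullback of \<open>\<alpha>\<close> to \<open>cover D\<close> into
  that of \<open>pullback_form (base C) (base D) \<phi> \<alpha>\<close> to \<open>cover C\<close>.
  That the latter form belongs to \<open>cls C\<close> includes its closedness.\<close>

lemma primitives_compose:
  assumes C: "novikov_object C" and D: "novikov_object D" and \<phi>: "novikov_morphism C D \<phi>t \<phi>"
    and f: "f \<in> primitives D"
  shows "restrict (f \<circ> \<phi>t) (points (cover C)) \<in> primitives C"
proof -
  note mf = novikov_cover[OF C] novikov_base[OF C] novikov_cover[OF D] novikov_base[OF D]
  note sm = morphism_cover[OF \<phi>] morphism_base[OF \<phi>] novikov_proj[OF C] novikov_proj[OF D]
  obtain \<alpha> where \<alpha>: "smooth_fun (cover D) f" "\<alpha> \<in> cls D"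
    "differential (cover D) f = pullback_form (cover D) (base D) (proj D) \<alpha>"
    using f by (rule primitivesE)
  let ?f = "restrict (f \<circ> \<phi>t) (points (cover C))" and ?\<beta> = "pullback_form (base C) (base D) \<phi> \<alpha>"
  have "differential (cover C) ?f = differential (cover C) (f \<circ> \<phi>t)"
    by (rule differential_cong[OF mf(1)]) simp
  also have "\<dots> = pullback_form (cover C) (cover D) \<phi>t (differential (cover D) f)"
    using pullback_differential[OF mf(1,3) sm(1) \<alpha>(1)] by simp
  also have "\<dots> = pullback_form (cover C) (base D) (proj D \<circ> \<phi>t) \<alpha>"
    by (simp add: \<alpha>(3) pullback_compose[OF mf(1,3,4) sm(1,4)])
  also have "\<dots> = pullback_form (cover C) (base D) (\<phi> \<circ> proj C) \<alpha>"
    by (rule fun_cong[OF pullback_cong[OF mf(1)]]) (simp add: morphism_proj[OF \<phi>])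
  also have "\<dots> = pullback_form (cover C) (base C) (proj C) ?\<beta>"
    by (simp add: pullback_compose[OF mf(1,2,4) sm(3,2)])
  finally have "differential (cover C) ?f = pullback_form (cover C) (base C) (proj C) ?\<beta>" .
  moreover have "?\<beta> \<in> cls C"
    using pullback_in_pullback_class[OF mf(2,4) sm(2) novikov_cls[OF D]] \<alpha>(2) novikov_cls[OF C]
    by (simp add: morphism_cls[OF \<phi>])
  moreover have "smooth_fun (cover C) ?f"
    by (rule smooth_fun_cong[OF mf(1) smooth_fun_compose[OF mf(1,3) sm(1) \<alpha>(1)]]) simp
  ultimately show ?thesis
    by (auto simp: primitives_def)
qed

text \<open>The vanishing of the pulled back class is an equality of sets of forms. Testing it on
  the zero form produces a form in \<open>cls C\<close> whose pullback differs from zero by an exact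
  form.\<close>

lemma primitives_nonempty:
  assumes C: "novikov_object C" shows "primitives C \<noteq> {}"
proof -
  note mf = novikov_cover[OF C]
  let ?p = "pullback_form (cover C) (base C) (proj C)"
  have "(\<lambda>\<kappa> y v. 0) \<in> pullback_class (cover C) (base C) (proj C) (cls C)"
    using C exact_zero[OF mf] by (simp add: novikov_object_def zero_class_def)
  then obtain \<alpha> where \<alpha>: "\<alpha> \<in> cls C" "exact_form (cover C) (\<lambda>\<kappa> y v. 0 - ?p \<alpha> \<kappa> y v)"
    by (auto simp: pullback_class_def cohomologous_def)
  have "exact_form (cover C) (?p \<alpha>)"
    using exact_diff[OF exact_zero[OF mf] \<alpha>(2)] by simp
  then obtain f where f: "smooth_fun (cover C) f" "?p \<alpha> = differential (cover C) f"
    by (auto simp: exact_form_def)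
  have "smooth_fun (cover C) (restrict f (points (cover C)))"
    by (rule smooth_fun_cong[OF mf f(1)]) simp
  moreover have "differential (cover C) (restrict f (points (cover C))) = ?p \<alpha>"
    unfolding f(2) by (rule differential_cong[OF mf]) simp
  ultimately have "restrict f (points (cover C)) \<in> primitives C"
    using \<alpha>(1) by (auto simp: primitives_def)
  then show ?thesis by blast
qed

lemma closed_form_empty:
  assumes "smooth_manifold M" "points M = {}" "closed_form M \<omega>"
  shows "\<omega> = (\<lambda>\<kappa> y v. 0)"
proof -
  have "chart_image \<kappa> = {}" if "\<kappa> \<in> atlas M" for \<kappa>
    using chart_subset[OF assms(1) that] assms(2) by (simp add: chart_image_def)
  then show ?thesis
    using assms(3) by (auto simp: closed_form_def one_form_def fun_eq_iff)
qed

text \<open>On an empty manifold every class is the zero class.\<close>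

lemma novikov_points_nonempty:
  assumes C: "novikov_object C" shows "points (cover C) \<noteq> {}"
proof
  assume "points (cover C) = {}"
  then have empty: "points (base C) = {}"
    using novikov_covering[OF C] by (auto simp: smooth_covering_def)
  note M = novikov_base[OF C]
  have "\<omega> = (\<lambda>\<kappa> y v. 0)" if "\<omega> \<in> cls C" for \<omega>
    using closed_form_empty[OF M empty H1_closed[OF novikov_cls[OF C] that]] .
  then have "cls C = {\<lambda>\<kappa> y v. 0}"
    using H1_nonempty[OF M novikov_cls[OF C]] by blast
  moreover have "zero_class (base C) = {\<lambda>\<kappa> y v. 0}"
    unfolding zero_class_def
    using closed_form_empty[OF M empty exact_imp_closed[OF M]] exact_zero[OF M] by blast
  ultimately show False
    using C by (simp add: novikov_object_def)
qed


subsection \<open>Unique lifting and deck transformations\<close>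

text \<open>Any condition on the value of \<open>f\<close> defines an open set. This applies to a
  fibre and to its complement, so fibres are open and closed.\<close>

lemma locally_constant_imp_constant:
  assumes X: "connected_space X"
    and loc: "\<And>x. x \<in> topspace X \<Longrightarrow> \<exists>W. openin X W \<and> x \<in> W \<and> (\<forall>y\<in>W. f y = f x)"
    and ab: "a \<in> topspace X" "b \<in> topspace X"
  shows "f a = f b"
proof -
  have op: "openin X {x \<in> topspace X. P (f x)}" for P
  proof (subst openin_subopen, intro ballI)
    fix x assume x: "x \<in> {x \<in> topspace X. P (f x)}"
    then have "\<exists>W. openin X W \<and> x \<in> W \<and> (\<forall>y\<in>W. f y = f x)"
      using loc[of x] by (elim CollectE conjE)
    then obtain W where W: "openin X W" "x \<in> W" "\<forall>y\<in>W. f y = f x"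
      by (elim exE conjE) (rule that)
    have "y \<in> {x \<in> topspace X. P (f x)}" if "y \<in> W" for y
      using bspec[OF W(3) that] x openin_subset[OF W(1)] that by auto
    then show "\<exists>T. openin X T \<and> x \<in> T \<and> T \<subseteq> {x \<in> topspace X. P (f x)}"
      using W(1,2) by blast
  qed
  have "topspace X - {x \<in> topspace X. f x = f a} = {x \<in> topspace X. f x \<noteq> f a}"
    by blast
  then have "closedin X {x \<in> topspace X. f x = f a}"
    using op[of "\<lambda>c. c \<noteq> f a"] by (simp add: closedin_def)
  then have "{x \<in> topspace X. f x = f a} = {} \<or> {x \<in> topspace X. f x = f a} = topspace X"
    using X op[of "\<lambda>c. c = f a"] unfolding connected_space_clopen_in by blast
  moreover have "a \<in> {x \<in> topspace X. f x = f a}" using ab(1) by simp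
  ultimately have "b \<in> {x \<in> topspace X. f x = f a}" using ab(2) by (metis empty_iff)
  then show ?thesis by simp
qed

text \<open>A vanishing derivative forces constancy on a coordinate ball, which is convex;
  connectedness then spreads local constancy over \<open>M\<close>.\<close>

lemma differential_zero_imp_constant:
  assumes M: "smooth_manifold M" "connected_space (mtop M)" and f: "smooth_fun M f"
    and zero: "differential M f = (\<lambda>\<kappa> y v. 0)" and ab: "a \<in> points M" "b \<in> points M"
  shows "f a = f b"
proof (rule locally_constant_imp_constant[OF M(2) _ ab])
  fix x assume "x \<in> points M"
  then obtain \<kappa> where \<kappa>: "\<kappa> \<in> atlas M" "x \<in> fst \<kappa>"
    using chart_at[OF M(1)] by blast
  obtain r where r: "r > 0" "ball (snd \<kappa> x) r \<subseteq> chart_image \<kappa>"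
    using chart_image_open[OF M(1) \<kappa>(1)] chart_in_image[OF \<kappa>(2)] openE by blast
  have const: "(f \<circ> chart_inv \<kappa>) y = (f \<circ> chart_inv \<kappa>) (snd \<kappa> x)" if "y \<in> ball (snd \<kappa> x) r" for y
  proof (rule has_derivative_zero_unique[OF convex_ball _ that])
    show "((f \<circ> chart_inv \<kappa>) has_derivative (\<lambda>h. 0)) (at z within ball (snd \<kappa> x) r)"
      if "z \<in> ball (snd \<kappa> x) r" for z
    proof -
      have z: "z \<in> chart_image \<kappa>" using that r(2) by blast
      have "frechet_derivative (f \<circ> chart_inv \<kappa>) (at z) = (\<lambda>h. 0)"
      proof
        fix v show "frechet_derivative (f \<circ> chart_inv \<kappa>) (at z) v = 0"
          using fun_cong[OF fun_cong[OF fun_cong[OF zero, of \<kappa>], of z], of v] z \<kappa>(1)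
          unfolding differential_def by simp
      qed
      then show ?thesis
        using smooth_on_differentiable[OF smooth_fun_chart[OF f \<kappa>(1)] z]
        by (auto simp: frechet_derivative_works intro: has_derivative_at_withinI)
    qed
    show "snd \<kappa> x \<in> ball (snd \<kappa> x) r" using r(1) by simp
  qed
  let ?W = "{p \<in> topspace (subtopology (mtop M) (fst \<kappa>)). snd \<kappa> p \<in> ball (snd \<kappa> x) r}"
  have "continuous_map (subtopology (mtop M) (fst \<kappa>)) (top_of_set (chart_image \<kappa>)) (snd \<kappa>)"
    using homeomorphic_imp_continuous_map[OF chart_homeomorphic[OF M(1) \<kappa>(1)]] .
  then have "openin (subtopology (mtop M) (fst \<kappa>)) ?W"
    by (rule openin_continuous_map_preimage) (use r(2) chart_image_open[OF M(1) \<kappa>(1)] in \<open>simp add: open_openin_trans\<close>)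
  then have "openin (mtop M) ?W"
    using openin_trans_full chart_openin[OF M(1) \<kappa>(1)] by blast
  moreover have "x \<in> ?W"
    using \<open>x \<in> points M\<close> \<kappa>(2) r(1) by simp
  moreover have "f p = f x" if "p \<in> ?W" for p
    using const[of "snd \<kappa> p"] that \<kappa>(2) by (simp add: chart_inv_chart[OF M(1) \<kappa>(1)])
  ultimately show "\<exists>W. openin (mtop M) W \<and> x \<in> W \<and> (\<forall>y\<in>W. f y = f x)"
    by blast
qed

text \<open>The set of agreement is closed because \<open>Y\<close> is Hausdorff and open because
  \<open>p\<close> is injective near a common value; it contains \<open>a\<close>.\<close>

lemma lifts_agree:
  assumes X: "connected_space X" and Y: "Hausdorff_space Y"
    and f: "continuous_map X Y f" and g: "continuous_map X Y g"
    and loc: "\<And>y. y \<in> topspace Y \<Longrightarrow> \<exists>V. openin Y V \<and> y \<in> V \<and> inj_on p V"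
    and lift: "\<And>x. x \<in> topspace X \<Longrightarrow> p (f x) = p (g x)"
    and a: "a \<in> topspace X" "f a = g a" and x: "x \<in> topspace X"
  shows "f x = g x"
proof -
  let ?A = "{x \<in> topspace X. f x = g x}"
  have "closedin X ?A"
    using Y f g by (rule closedin_continuous_maps_eq)
  moreover have "openin X ?A"
  proof (subst openin_subopen, intro ballI)
    fix x assume x: "x \<in> ?A"
    have "f x \<in> topspace Y"
      using f x by (fastforce dest: continuous_map_image_subset_topspace)
    then obtain V where V: "openin Y V" "f x \<in> V" "inj_on p V"
      using loc by blast
    let ?W = "{x \<in> topspace X. f x \<in> V} \<inter> {x \<in> topspace X. g x \<in> V}"
    have "openin X ?W"
      using openin_continuous_map_preimage[OF f V(1)] openin_continuous_map_preimage[OF g V(1)]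
      by (rule openin_Int)
    moreover have "?W \<subseteq> ?A"
      using V(3) lift by (auto dest: inj_onD)
    ultimately show "\<exists>T. openin X T \<and> x \<in> T \<and> T \<subseteq> ?A"
      using x V(2) by (intro exI[of _ ?W]) auto
  qed
  ultimately have "?A = topspace X"
    using X a unfolding connected_space_clopen_in by blast
  with x show ?thesis by blast
qed

text \<open>Extracts from an evenly covered neighbourhood a single sheet with its smooth inverse
  \<open>s\<close>, which serves both local injectivity and the smoothness of deck
  transformations.\<close>

lemma covering_sheet:
  assumes "smooth_covering M N p" "x \<in> points M"
  obtains U V s where "openin (mtop N) U" "openin (mtop M) V" "x \<in> V" "p x \<in> U"
    "smooth_map (open_submanifold N U) (open_submanifold M V) s" "\<forall>z\<in>V. s (p z) = z"
proof -
  have "p x \<in> points N"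
    using assms by (auto simp: smooth_covering_def)
  then have "\<exists>U. openin (mtop N) U \<and> p x \<in> U \<and>
      (\<exists>\<V>. pairwise disjnt \<V> \<and> \<Union>\<V> = {x \<in> points M. p x \<in> U} \<and>
         (\<forall>V\<in>\<V>. openin (mtop M) V \<and>
            diffeomorphism (open_submanifold M V) (open_submanifold N U) p))"
    using assms(1) unfolding smooth_covering_def by (elim conjE) (rule bspec)
  then obtain U \<V> where U: "openin (mtop N) U" "p x \<in> U"
    and \<V>: "\<Union>\<V> = {x \<in> points M. p x \<in> U}" "\<And>V. V \<in> \<V> \<Longrightarrow> openin (mtop M) V \<and>
      diffeomorphism (open_submanifold M V) (open_submanifold N U) p"
    by (elim exE conjE) (rule that, assumption+, erule bspec)
  obtain V where V: "V \<in> \<V>" "x \<in> V"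
    using \<V>(1) U(2) assms(2) by blast
  obtain s where s: "smooth_map (open_submanifold N U) (open_submanifold M V) s"
    "\<forall>z\<in>points (open_submanifold M V). s (p z) = z"
    using \<V>(2)[OF V(1)] unfolding diffeomorphism_def by blast
  have "points (open_submanifold M V) = V"
    using \<V>(2)[OF V(1)] openin_subset by (auto simp: open_submanifold_def)
  with s U V \<V>(2) that show thesis by blast
qed

lemma covering_locally_injective:
  assumes "smooth_covering M N p" "x \<in> points M"
  shows "\<exists>V. openin (mtop M) V \<and> x \<in> V \<and> inj_on p V"
proof -
  obtain V s where "openin (mtop M) V" "x \<in> V" "\<forall>z\<in>V. s (p z) = z"
    by (rule covering_sheet[OF assms], rule that)
  then show ?thesis
    by (intro exI[of _ V]) (auto intro: inj_on_inverseI[of V s])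
qed

lemma chart_image_open_subset:
  assumes M: "smooth_manifold M" and \<kappa>: "\<kappa> \<in> atlas M" and W: "openin (mtop M) W"
  shows "open (snd \<kappa> ` (fst \<kappa> \<inter> W))"
proof -
  have "openin (subtopology (mtop M) (fst \<kappa>)) (fst \<kappa> \<inter> W)"
    using W by (simp add: openin_subtopology_Int2)
  then have "openin (top_of_set (chart_image \<kappa>)) (snd \<kappa> ` (fst \<kappa> \<inter> W))"
    using homeomorphic_imp_open_map[OF chart_homeomorphic[OF M \<kappa>]] by (simp add: open_map_def)
  then show ?thesis
    using chart_image_open[OF M \<kappa>] openin_open_trans by blast
qed

lemma deck_in_points: "\<tau> \<in> deck_group C \<Longrightarrow> x \<in> points (cover C) \<Longrightarrow> \<tau> x \<in> points (cover C)"
  using homeomorphic_imp_surjective_map by (fastforce simp: deck_group_def)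

lemma deck_continuous: "\<tau> \<in> deck_group C \<Longrightarrow> continuous_map (mtop (cover C)) (mtop (cover C)) \<tau>"
  by (simp add: deck_group_def homeomorphic_imp_continuous_map)

text \<open>Near every point a deck transformation is the projection followed by a local inverse of it.\<close>

lemma deck_smooth:
  assumes M: "smooth_manifold (cover C)" and N: "smooth_manifold (base C)"
    and cov: "smooth_covering (cover C) (base C) (proj C)" and \<tau>: "\<tau> \<in> deck_group C"
  shows "smooth_map (cover C) (cover C) \<tau>"
proof -
  let ?M = "cover C" and ?N = "base C" and ?p = "proj C"
  have p: "smooth_map ?M ?N ?p" using cov by (simp add: smooth_covering_def)
  have cont: "continuous_map (mtop ?M) (mtop ?M) \<tau>"
    using \<tau> by (rule deck_continuous)
  have p\<tau>: "?p (\<tau> x) = ?p x" if "x \<in> points ?M" for x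
    using \<tau> that by (simp add: deck_group_def)
  have "smooth_on (snd \<kappa> ` {a \<in> fst \<kappa>. \<tau> a \<in> fst \<kappa>'}) (snd \<kappa>' \<circ> \<tau> \<circ> chart_inv \<kappa>)"
    (is "smooth_on ?S ?h") if \<kappa>: "\<kappa> \<in> atlas ?M" and \<kappa>': "\<kappa>' \<in> atlas ?M" for \<kappa> \<kappa>'
  proof (rule smooth_on_local)
    fix y assume "y \<in> ?S"
    then obtain x where x: "x \<in> fst \<kappa>" "\<tau> x \<in> fst \<kappa>'" "y = snd \<kappa> x"
      by auto
    have xM: "x \<in> points ?M" using chart_subset[OF M \<kappa>] x(1) by blast
    have \<tau>xM: "\<tau> x \<in> points ?M" using chart_subset[OF M \<kappa>'] x(2) by blast
    obtain U V s where s: "openin (mtop ?N) U" "openin (mtop ?M) V" "\<tau> x \<in> V" "?p (\<tau> x) \<in> U"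
      "smooth_map (open_submanifold ?N U) (open_submanifold ?M V) s" "\<forall>z\<in>V. s (?p z) = z"
      by (rule covering_sheet[OF cov \<tau>xM], rule that)
    obtain \<mu> where \<mu>: "\<mu> \<in> atlas ?N" "?p x \<in> fst \<mu>"
      using chart_at[OF N smooth_map_in_points[OF p xM]] .
    note inv = chart_inv_chart[OF M \<kappa>] chart_inv_chart[OF N \<mu>(1)]
    \<comment> \<open>Smoothness of \<open>s\<close> is stated in the charts of open submanifolds.
      These keep the coordinate map but shrink its domain, and \<open>chart_inv\<close> depends on
      the domain, so its values have to be identified again.\<close>
    let ?\<mu> = "(fst \<mu> \<inter> U, snd \<mu>)"
    have inv\<mu>: "chart_inv ?\<mu> (snd \<mu> b) = b" if "b \<in> fst \<mu>" "b \<in> U" for b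
      using inj_on_subset[OF chart_inj[OF N \<mu>(1)]] that by (simp add: chart_inv_def)
    let ?f = "snd \<mu> \<circ> ?p \<circ> chart_inv \<kappa>" and ?g = "snd \<kappa>' \<circ> s \<circ> chart_inv ?\<mu>"
    let ?A = "snd \<kappa> ` {a \<in> fst \<kappa>. ?p a \<in> fst \<mu>}"
      and ?B = "snd \<mu> ` {b \<in> fst \<mu> \<inter> U. s b \<in> fst \<kappa>' \<inter> V}"
    have "?\<mu> \<in> atlas (open_submanifold ?N U)" "(fst \<kappa>' \<inter> V, snd \<kappa>') \<in> atlas (open_submanifold ?M V)"
      using \<mu>(1) \<kappa>' by (force simp: open_submanifold_def)+
    from smooth_map_chart[OF s(5) this] have gB: "smooth_on ?B ?g"
      by simp
    have fA: "smooth_on ?A ?f"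
      by (rule smooth_map_chart[OF p \<kappa> \<mu>(1)])
    \<comment> \<open>Where \<open>?p a\<close> lies in \<open>U\<close>, the point
      \<open>s (?p a)\<close> is the one on the sheet \<open>V\<close>, while
      \<open>\<tau> a\<close> may lie on another sheet. Keeping \<open>\<tau> a\<close> inside
      \<open>V\<close> makes the two equal; continuity of \<open>\<tau>\<close> makes this an open
      condition.\<close>
    let ?W = "snd \<kappa> ` (fst \<kappa> \<inter> {a \<in> points ?M. \<tau> a \<in> V})"
    have W: "open ?W"
      using openin_continuous_map_preimage[OF cont s(2)] by (rule chart_image_open_subset[OF M \<kappa>])
    let ?R = "?A \<inter> ?f -` ?B \<inter> ?W"
    have R: "smooth_on (?A \<inter> ?f -` ?B) (?g \<circ> ?f)"
      using fA gB by (rule smooth_on_compose_preimage)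
    have R': "\<exists>a\<in>fst \<kappa>. z = snd \<kappa> a \<and> \<tau> a \<in> fst \<kappa>' \<and> (?g \<circ> ?f) z = ?h z" if z: "z \<in> ?R" for z
    proof -
      have zA: "z \<in> ?A" and zB: "?f z \<in> ?B" and zW: "z \<in> ?W"
        using z by blast+
      obtain a where a: "a \<in> fst \<kappa>" "?p a \<in> fst \<mu>" "z = snd \<kappa> a"
        using zA by blast
      have "?f z = snd \<mu> (?p a)" using a by (simp add: inv)
      then obtain b where b: "b \<in> fst \<mu>" "b \<in> U" "s b \<in> fst \<kappa>'" "snd \<mu> (?p a) = snd \<mu> b"
        using zB by auto
      have pa: "?p a = b"
        using chart_inj[OF N \<mu>(1)] a(2) b(1,4) by (auto dest: inj_onD)
      obtain a' where a': "a' \<in> fst \<kappa>" "a' \<in> points ?M" "\<tau> a' \<in> V" "z = snd \<kappa> a'"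
        using zW by blast
      then have "a' = a"
        using a chart_inj[OF M \<kappa>] by (auto dest: inj_onD)
      then have "s b = \<tau> a"
        using a' p\<tau> bspec[OF s(6), of "\<tau> a"] pa by simp
      then show ?thesis
        using a b pa by (intro bexI[of _ a]) (simp_all add: inv inv\<mu>)
    qed
    have "smooth_on ?R (?g \<circ> ?f)"
      by (rule smooth_on_subset[OF R]) (use smooth_on_open[OF R] W in auto)
    then have "smooth_on ?R ?h"
    proof (rule smooth_on_cong)
      show "(?g \<circ> ?f) z = ?h z" if "z \<in> ?R" for z
        using R'[OF that] by (elim bexE conjE)
    qed
    moreover have "?R \<subseteq> ?S"
    proof
      show "z \<in> ?S" if "z \<in> ?R" for z
        using R'[OF that] by (elim bexE conjE) (rule image_eqI, assumption, simp)
    qed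
    moreover have "y \<in> ?R"
    proof -
      have "?p x \<in> fst \<mu> \<inter> U" "s (?p x) \<in> fst \<kappa>' \<inter> V"
        using \<mu>(2) s(3,4,6) x(2) p\<tau>[OF xM] by auto
      then have "snd \<mu> (?p x) \<in> ?B" by blast
      then have "y \<in> ?f -` ?B" using x by (simp add: inv)
      moreover have "y \<in> ?A" "y \<in> ?W"
        using x \<mu>(2) xM s(3) by auto
      ultimately show ?thesis by blast
    qed
    ultimately show "\<exists>U. y \<in> U \<and> U \<subseteq> ?S \<and> smooth_on U ?h"
      by (intro exI conjI)
  qed
  with cont show ?thesis
    by (simp add: smooth_map_def)
qed

section \<open>The period of a deck transformation\<close>

lemma primitive_deck_shift:
  assumes C: "novikov_object C" and \<tau>: "\<tau> \<in> deck_group C" and f: "f \<in> primitives C"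
    and xy: "x \<in> points (cover C)" "y \<in> points (cover C)"
  shows "f (\<tau> x) - f x = f (\<tau> y) - f y"
proof -
  let ?M = "cover C" and ?N = "base C" and ?p = "proj C"
  note M = novikov_cover[OF C] and N = novikov_base[OF C] and p = novikov_proj[OF C]
  have s: "smooth_map ?M ?M \<tau>"
    using M N novikov_covering[OF C] \<tau> by (rule deck_smooth)
  obtain \<alpha> where \<alpha>: "smooth_fun ?M f" "\<alpha> \<in> cls C" "differential ?M f = pullback_form ?M ?N ?p \<alpha>"
    using f by (rule primitivesE)
  have "differential ?M (f \<circ> \<tau>) = pullback_form ?M ?M \<tau> (pullback_form ?M ?N ?p \<alpha>)"
    using pullback_differential[OF M M s \<alpha>(1)] by (simp add: \<alpha>(3))
  also have "\<dots> = pullback_form ?M ?N (?p \<circ> \<tau>) \<alpha>"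
    by (rule pullback_compose[OF M M N s p])
  also have "\<dots> = pullback_form ?M ?N ?p \<alpha>"
    by (rule fun_cong[OF pullback_cong[OF M]]) (use \<tau> in \<open>simp add: deck_group_def\<close>)
  finally have "differential ?M (\<lambda>x. (f \<circ> \<tau>) x - f x) = (\<lambda>\<kappa> y v. 0)"
    using differential_diff[OF smooth_fun_compose[OF M M s \<alpha>(1)] \<alpha>(1)] by (simp add: \<alpha>(3))
  from differential_zero_imp_constant[OF M novikov_connected[OF C]
      smooth_fun_diff[OF smooth_fun_compose[OF M M s \<alpha>(1)] \<alpha>(1)] this xy]
  show ?thesis by simp
qed

text \<open>Two forms in the class differ by the differential of some \<open>g\<close> on the base.
  The function \<open>g \<circ> proj C\<close> takes the same value at \<open>x\<close> and
  \<open>\<tau> x\<close>, so it drops out of the shift.\<close>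

lemma primitive_deck_shift_unique:
  assumes C: "novikov_object C" and \<tau>: "\<tau> \<in> deck_group C"
    and f: "f \<in> primitives C" and f': "f' \<in> primitives C" and x: "x \<in> points (cover C)"
  shows "f (\<tau> x) - f x = f' (\<tau> x) - f' x"
proof -
  let ?M = "cover C" and ?N = "base C" and ?p = "proj C"
  note M = novikov_cover[OF C] and N = novikov_base[OF C] and p = novikov_proj[OF C]
  obtain \<alpha> where \<alpha>: "smooth_fun ?M f" "\<alpha> \<in> cls C" "differential ?M f = pullback_form ?M ?N ?p \<alpha>"
    using f by (rule primitivesE)
  obtain \<alpha>' where \<alpha>': "smooth_fun ?M f'" "\<alpha>' \<in> cls C" "differential ?M f' = pullback_form ?M ?N ?p \<alpha>'"
    using f' by (rule primitivesE)
  obtain g where g: "smooth_fun ?N g" "(\<lambda>\<kappa> y v. \<alpha> \<kappa> y v - \<alpha>' \<kappa> y v) = differential ?N g"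
    using H1_exact_diff[OF novikov_cls[OF C] \<alpha>'(2) \<alpha>(2)] by (auto simp: exact_form_def)
  have gp: "smooth_fun ?M (g \<circ> ?p)" by (rule smooth_fun_compose[OF M N p g(1)])
  have "differential ?M (g \<circ> ?p) = (\<lambda>\<kappa> y v. differential ?M f \<kappa> y v - differential ?M f' \<kappa> y v)"
    using pullback_differential[OF M N p g(1)] by (simp add: g(2)[symmetric] pullback_diff \<alpha>(3) \<alpha>'(3))
  then have "differential ?M (\<lambda>x. (f x - f' x) - (g \<circ> ?p) x) = (\<lambda>\<kappa> y v. 0)"
    using differential_diff[OF smooth_fun_diff[OF \<alpha>(1) \<alpha>'(1)] gp] differential_diff[OF \<alpha>(1) \<alpha>'(1)]
    by simp
  moreover have "\<tau> x \<in> points ?M"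
    using \<tau> x by (rule deck_in_points)
  ultimately have "(f (\<tau> x) - f' (\<tau> x)) - (g \<circ> ?p) (\<tau> x) = (f x - f' x) - (g \<circ> ?p) x"
    using differential_zero_imp_constant[OF M novikov_connected[OF C]
        smooth_fun_diff[OF smooth_fun_diff[OF \<alpha>(1) \<alpha>'(1)] gp]] x by blast
  moreover have "?p (\<tau> x) = ?p x"
    using \<tau> x by (simp add: deck_group_def)
  ultimately show ?thesis by simp
qed

text \<open>Justifies the definite description in \<open>deck_period\<close>: existence is the
  independence of the shift from the point and from the primitive, and uniqueness is read off at the
  given \<open>f\<close> and \<open>x\<close>.\<close>

lemma deck_period:
  assumes C: "novikov_object C" and \<tau>: "\<tau> \<in> deck_group C"
    and f: "f \<in> primitives C" and x: "x \<in> points (cover C)"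
  shows "f (\<tau> x) = f x + deck_period C \<tau>"
proof -
  define r where "r = f (\<tau> x) - f x"
  have shift: "f' (\<tau> y) - f' y = r" if "f' \<in> primitives C" "y \<in> points (cover C)" for f' y
    using primitive_deck_shift_unique[OF C \<tau> that(1) f that(2)] primitive_deck_shift[OF C \<tau> f that(2) x]
    by (simp add: r_def)
  have "deck_period C \<tau> = r"
    unfolding deck_period_def
  proof (rule the_equality)
    show "\<forall>f\<in>primitives C. \<forall>x\<in>points (cover C). f (\<tau> x) = f x + r"
      using shift by (metis add.commute diff_add_cancel)
    show "s = r" if "\<forall>f\<in>primitives C. \<forall>x\<in>points (cover C). f (\<tau> x) = f x + s" for s
      using bspec[OF bspec[OF that f] x] by (simp add: r_def)
  qed
  then show ?thesis by (simp add: r_def)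
qed


subsection \<open>Functoriality\<close>

lemma carrier_novikov_pi1:
  "carrier (novikov_pi1 C) = {G \<in> (\<Pi>\<^sub>E f\<in>primitives C. carrier (pi1_limit (mtop (cover C)) f)).
     \<forall>f\<in>primitives C. \<forall>f'\<in>primitives C. \<forall>K. (\<forall>x\<in>points (cover C). \<bar>f x - f' x\<bar> \<le> K) \<longrightarrow>
       limit_map (mtop (cover C)) f (mtop (cover C)) f' K (\<lambda>x. x) (G f) = G f'}"
  by (simp add: novikov_pi1_def Let_def comparison_eq_limit_map)

lemma mult_novikov_pi1:
  "G \<otimes>\<^bsub>novikov_pi1 C\<^esub> G' = (\<lambda>f\<in>primitives C. G f \<otimes>\<^bsub>pi1_limit (mtop (cover C)) f\<^esub> G' f)"
  by (simp add: novikov_pi1_def Let_def)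

lemma novikov_pi1_component:
  "G \<in> carrier (novikov_pi1 C) \<Longrightarrow> f \<in> primitives C \<Longrightarrow> G f \<in> carrier (pi1_limit (mtop (cover C)) f)"
  by (auto simp: carrier_novikov_pi1)

lemma group_novikov_pi1: "group (novikov_pi1 C)"
proof -
  let ?X = "mtop (cover C)" and ?P = "primitives C"
  \<comment> \<open>A pair of primitives can satisfy many bounds, and every bound \<open>K\<close>
    imposes its own relation; hence relations are triples that carry the map.\<close>
  let ?R = "{(f, f', comparison ?X f f' K) | f f' K.
    f \<in> ?P \<and> f' \<in> ?P \<and> (\<forall>x\<in>topspace ?X. \<bar>f x - f' x\<bar> \<le> K)}"
  have "group (product_group ?P (pi1_limit ?X) \<lparr>carrier :=
      {G \<in> (\<Pi>\<^sub>E f\<in>?P. carrier (pi1_limit ?X f)). \<forall>(f, f', \<theta>)\<in>?R. \<theta> (G f) = G f'}\<rparr>)"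
  proof (rule group_compatible_families)
    fix f f' \<theta> assume "(f, f', \<theta>) \<in> ?R"
    then show "f \<in> ?P \<and> f' \<in> ?P \<and> \<theta> \<in> hom (pi1_limit ?X f) (pi1_limit ?X f')"
      by (auto simp: comparison_eq_limit_map intro!: limit_map_hom sublevel_map_bounded)
  qed (rule group_pi1_limit)
  moreover have "{G \<in> (\<Pi>\<^sub>E f\<in>?P. carrier (pi1_limit ?X f)). \<forall>(f, f', \<theta>)\<in>?R. \<theta> (G f) = G f'}
      = carrier (novikov_pi1 C)"
    unfolding carrier_novikov_pi1 comparison_eq_limit_map by blast
  ultimately show ?thesis
    by (simp add: novikov_pi1_def Let_def)
qed

lemma novikov_map_component:
  "f \<in> primitives D \<Longrightarrow> novikov_map C D \<phi>t G f
    = limit_map (mtop (cover C)) (restrict (f \<circ> \<phi>t) (points (cover C))) (mtop (cover D)) f 0 \<phi>t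
        (G (restrict (f \<circ> \<phi>t) (points (cover C))))"
  by (simp add: novikov_map_def limit_map_def Let_def)

lemma deck_action_component:
  "f \<in> primitives C \<Longrightarrow> deck_action C \<tau> G f
    = limit_map (mtop (cover C)) f (mtop (cover C)) f (deck_period C \<tau>) \<tau> (G f)"
  by (simp add: deck_action_def limit_map_def Let_def)

lemma novikov_map_extensional: "novikov_map C D \<phi>t G \<in> extensional (primitives D)"
  by (simp add: novikov_map_def)

text \<open>Written with \<open>h - 0\<close> so that it has the form expected by the lemmas on
  \<open>limit_map\<close>, with shift 0.\<close>

lemma sublevel_map_restrict:
  "smooth_map M N \<phi> \<Longrightarrow>
     sublevel_map (mtop M) (restrict (f \<circ> \<phi>) (points M)) (h - 0) (mtop N) f h \<phi>"
  by (simp add: sublevel_map_def smooth_map_def)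

text \<open>A bound for \<open>f\<close> and \<open>f'\<close> on \<open>cover D\<close> also bounds
  the difference of their compositions with \<open>\<phi>t\<close> on \<open>cover C\<close>.
  Comparing before or after applying \<open>\<phi>t\<close> is therefore the same map with shift
  \<open>K\<close>, and the comparison on the source side is known for \<open>G\<close>.\<close>

lemma novikov_map_closed:
  assumes C: "novikov_object C" and D: "novikov_object D" and \<phi>: "novikov_morphism C D \<phi>t \<phi>"
    and G: "G \<in> carrier (novikov_pi1 C)"
  shows "novikov_map C D \<phi>t G \<in> carrier (novikov_pi1 D)"
proof -
  let ?X = "mtop (cover C)" and ?Y = "mtop (cover D)"
  let ?r = "\<lambda>f. restrict (f \<circ> \<phi>t) (points (cover C))"
  note sub = sublevel_map_restrict[OF morphism_cover[OF \<phi>]]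
  have r: "?r f \<in> primitives C" if "f \<in> primitives D" for f
    using primitives_compose[OF C D \<phi> that] .
  have Gr: "G (?r f) \<in> carrier (pi1_limit ?X (?r f))" if "f \<in> primitives D" for f
    using novikov_pi1_component[OF G r[OF that]] .
  have "novikov_map C D \<phi>t G f \<in> carrier (pi1_limit ?Y f)" if "f \<in> primitives D" for f
    unfolding novikov_map_component[OF that]
    by (rule hom_in_carrier[OF limit_map_hom[OF sub] Gr[OF that]])
  moreover have "limit_map ?Y f ?Y f' K (\<lambda>x. x) (novikov_map C D \<phi>t G f) = novikov_map C D \<phi>t G f'"
    if f: "f \<in> primitives D" "f' \<in> primitives D" and K: "\<forall>y\<in>points (cover D). \<bar>f y - f' y\<bar> \<le> K" for f f' K
  proof -
    have K': "\<forall>x\<in>points (cover C). \<bar>?r f x - ?r f' x\<bar> \<le> K"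
      using K smooth_map_in_points[OF morphism_cover[OF \<phi>]] by simp
    have "limit_map ?Y f ?Y f' K (\<lambda>x. x) (novikov_map C D \<phi>t G f)
        = limit_map ?X (?r f) ?Y f' (0 + K) \<phi>t (G (?r f))"
      unfolding novikov_map_component[OF f(1)]
      by (rule limit_map_comp[OF sub sublevel_map_bounded[OF K] _ Gr[OF f(1)]]) simp
    also have "\<dots> = limit_map ?X (?r f) ?Y f' (K + 0) \<phi>t (G (?r f))"
      by simp
    also have "\<dots> = limit_map ?X (?r f') ?Y f' 0 \<phi>t (limit_map ?X (?r f) ?X (?r f') K (\<lambda>x. x) (G (?r f)))"
      by (rule limit_map_comp[OF sublevel_map_bounded[OF K'] sub _ Gr[OF f(1)], symmetric]) simp
    also have "limit_map ?X (?r f) ?X (?r f') K (\<lambda>x. x) (G (?r f)) = G (?r f')"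
      using G r[OF f(1)] r[OF f(2)] K' unfolding carrier_novikov_pi1 by blast
    finally show ?thesis
      by (simp only: novikov_map_component[OF f(2)])
  qed
  ultimately show ?thesis
    using novikov_map_extensional by (auto simp: carrier_novikov_pi1 PiE_iff)
qed

lemma novikov_map_hom:
  assumes C: "novikov_object C" and D: "novikov_object D" and \<phi>: "novikov_morphism C D \<phi>t \<phi>"
  shows "group_hom (novikov_pi1 C) (novikov_pi1 D) (novikov_map C D \<phi>t)"
proof -
  have "novikov_map C D \<phi>t \<in> hom (novikov_pi1 C) (novikov_pi1 D)"
  proof (rule homI)
    fix G G' assume G: "G \<in> carrier (novikov_pi1 C)" "G' \<in> carrier (novikov_pi1 C)"
    show "novikov_map C D \<phi>t (G \<otimes>\<^bsub>novikov_pi1 C\<^esub> G')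
        = novikov_map C D \<phi>t G \<otimes>\<^bsub>novikov_pi1 D\<^esub> novikov_map C D \<phi>t G'"
    proof (rule extensionalityI[OF novikov_map_extensional])
      show "novikov_map C D \<phi>t G \<otimes>\<^bsub>novikov_pi1 D\<^esub> novikov_map C D \<phi>t G' \<in> extensional (primitives D)"
        by (simp add: mult_novikov_pi1)
      fix f assume f: "f \<in> primitives D"
      note r = primitives_compose[OF C D \<phi> f]
      show "novikov_map C D \<phi>t (G \<otimes>\<^bsub>novikov_pi1 C\<^esub> G') f
          = (novikov_map C D \<phi>t G \<otimes>\<^bsub>novikov_pi1 D\<^esub> novikov_map C D \<phi>t G') f"
        using f r hom_mult[OF limit_map_hom[OF sublevel_map_restrict[OF morphism_cover[OF \<phi>]]]
            novikov_pi1_component[OF G(1) r] novikov_pi1_component[OF G(2) r]]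
        by (simp add: mult_novikov_pi1 novikov_map_component)
    qed
  qed (rule novikov_map_closed[OF C D \<phi>])
  then show ?thesis
    by (simp add: group_hom_def group_hom_axioms_def group_novikov_pi1)
qed

lemma deck_lifts_agree:
  assumes D: "novikov_object D" and X: "connected_space X"
    and f: "continuous_map X (mtop (cover D)) f" and g: "continuous_map X (mtop (cover D)) g"
    and "\<And>x. x \<in> topspace X \<Longrightarrow> proj D (f x) = proj D (g x)"
    and "a \<in> topspace X" "f a = g a" "x \<in> topspace X"
  shows "f x = g x"
  using X _ f g covering_locally_injective[OF novikov_covering[OF D]] assms(5-8)
  by (rule lifts_agree) (use novikov_cover[OF D] in \<open>simp add: smooth_manifold_def\<close>)

lemma ex1_covers_deck:
  assumes C: "novikov_object C" and D: "novikov_object D" and \<phi>: "novikov_morphism C D \<phi>t \<phi>"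
    and \<tau>: "\<tau> \<in> deck_group C"
  shows "\<exists>!\<sigma>. covers_deck C D \<phi>t \<tau> \<sigma>"
proof -
  let ?X = "mtop (cover C)" and ?Y = "mtop (cover D)"
  have cont: "continuous_map ?X ?Y \<phi>t"
    using morphism_cover[OF \<phi>] by (simp add: smooth_map_def)
  have in_Y: "\<phi>t x \<in> points (cover D)" if "x \<in> points (cover C)" for x
    using smooth_map_in_points[OF morphism_cover[OF \<phi>] that] .
  have proj\<tau>: "proj D (\<phi>t (\<tau> x)) = proj D (\<phi>t x)" if "x \<in> points (cover C)" for x
    using that \<tau> deck_in_points[OF \<tau> that] by (simp add: morphism_proj[OF \<phi>] deck_group_def)
  \<comment> \<open>The point at which lifts are compared; it exists because the class of
    \<open>C\<close> is nonzero.\<close>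
  obtain a where a: "a \<in> points (cover C)"
    using novikov_points_nonempty[OF C] by blast
  have "\<exists>\<sigma>\<in>deck_group D. \<sigma> (\<phi>t a) = \<phi>t (\<tau> a)"
    using D in_Y[OF a] in_Y[OF deck_in_points[OF \<tau> a]] proj\<tau>[OF a] by (simp add: novikov_object_def)
  then obtain \<sigma> where \<sigma>: "\<sigma> \<in> deck_group D" "\<sigma> (\<phi>t a) = \<phi>t (\<tau> a)"
    by blast
  have "(\<phi>t \<circ> \<tau>) x = (\<sigma> \<circ> \<phi>t) x" if "x \<in> points (cover C)" for x
  proof (rule deck_lifts_agree[OF D novikov_connected[OF C] _ _ _ a _ that])
    show "continuous_map ?X ?Y (\<phi>t \<circ> \<tau>)"
      using deck_continuous[OF \<tau>] cont by (rule continuous_map_compose)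
    show "continuous_map ?X ?Y (\<sigma> \<circ> \<phi>t)"
      using cont deck_continuous[OF \<sigma>(1)] by (rule continuous_map_compose)
    show "proj D ((\<phi>t \<circ> \<tau>) x) = proj D ((\<sigma> \<circ> \<phi>t) x)" if "x \<in> points (cover C)" for x
      using proj\<tau>[OF that] \<sigma>(1) in_Y[OF that] by (simp add: deck_group_def)
    show "(\<phi>t \<circ> \<tau>) a = (\<sigma> \<circ> \<phi>t) a"
      using \<sigma>(2) by simp
  qed
  then have "covers_deck C D \<phi>t \<tau> \<sigma>"
    using \<sigma>(1) by (simp add: covers_deck_def)
  \<comment> \<open>Agreement at \<open>\<phi>t a\<close> propagates over the connected
    \<open>cover D\<close>, beyond the image of \<open>\<phi>t\<close>; extensionality then gives
    equality of functions.\<close>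
  moreover have "\<sigma>' = \<sigma>" if "covers_deck C D \<phi>t \<tau> \<sigma>'" for \<sigma>'
  proof (rule extensionalityI[of _ "points (cover D)"])
    have \<sigma>': "\<sigma>' \<in> deck_group D" "\<sigma>' (\<phi>t a) = \<sigma> (\<phi>t a)"
      using that a \<sigma>(2) by (simp_all add: covers_deck_def)
    show "\<sigma>' \<in> extensional (points (cover D))" "\<sigma> \<in> extensional (points (cover D))"
      using \<sigma> \<sigma>' by (simp_all add: deck_group_def)
    show "\<sigma>' y = \<sigma> y" if "y \<in> points (cover D)" for y
      by (rule deck_lifts_agree[OF D novikov_connected[OF D] deck_continuous[OF \<sigma>'(1)]
            deck_continuous[OF \<sigma>(1)] _ in_Y[OF a] \<sigma>'(2) that])
        (use \<sigma>(1) \<sigma>'(1) in \<open>simp add: deck_group_def\<close>)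
  qed
  ultimately show ?thesis by blast
qed

lemma sublevel_map_deck:
  assumes "novikov_object C" "\<tau> \<in> deck_group C" "f \<in> primitives C"
  shows "sublevel_map (mtop (cover C)) f (h - deck_period C \<tau>) (mtop (cover C)) f h \<tau>"
  using deck_continuous[OF assms(2)] deck_period[OF assms] by (simp add: sublevel_map_def)

lemma deck_period_covers:
  assumes C: "novikov_object C" and D: "novikov_object D" and \<phi>: "novikov_morphism C D \<phi>t \<phi>"
    and \<tau>: "\<tau> \<in> deck_group C" and \<sigma>: "covers_deck C D \<phi>t \<tau> \<sigma>"
  shows "deck_period D \<sigma> = deck_period C \<tau>"
proof -
  obtain f where f: "f \<in> primitives D"
    using primitives_nonempty[OF D] by blast
  obtain x where x: "x \<in> points (cover C)"
    using novikov_points_nonempty[OF C] by blast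
  have "f (\<sigma> (\<phi>t x)) = f (\<phi>t x) + deck_period D \<sigma>"
    using \<sigma> f smooth_map_in_points[OF morphism_cover[OF \<phi>] x]
    by (intro deck_period[OF D]) (simp_all add: covers_deck_def)
  moreover have "f (\<phi>t (\<tau> x)) = f (\<phi>t x) + deck_period C \<tau>"
    using deck_period[OF C \<tau> primitives_compose[OF C D \<phi> f] x] x deck_in_points[OF \<tau> x] by simp
  ultimately show ?thesis
    using \<sigma> x by (simp add: covers_deck_def)
qed

text \<open>At each primitive both sides are the limit map of \<open>\<phi>t \<circ> \<tau>\<close>,
  which is \<open>\<sigma> \<circ> \<phi>t\<close> on the covering space. Equality of the periods of
  \<open>\<tau>\<close> and \<open>\<sigma>\<close> makes the shifts match.\<close>

lemma novikov_map_equivariant: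
  assumes C: "novikov_object C" and D: "novikov_object D" and \<phi>: "novikov_morphism C D \<phi>t \<phi>"
    and \<tau>: "\<tau> \<in> deck_group C" and \<sigma>: "covers_deck C D \<phi>t \<tau> \<sigma>"
    and G: "G \<in> carrier (novikov_pi1 C)"
  shows "novikov_map C D \<phi>t (deck_action C \<tau> G) = deck_action D \<sigma> (novikov_map C D \<phi>t G)"
proof (rule extensionalityI[OF novikov_map_extensional])
  let ?X = "mtop (cover C)" and ?Y = "mtop (cover D)"
  show "deck_action D \<sigma> (novikov_map C D \<phi>t G) \<in> extensional (primitives D)"
    by (simp add: deck_action_def Let_def)
  fix f assume f: "f \<in> primitives D"
  let ?r = "restrict (f \<circ> \<phi>t) (points (cover C))" and ?u = "deck_period C \<tau>"
  note r = primitives_compose[OF C D \<phi> f]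
  note sub = sublevel_map_restrict[OF morphism_cover[OF \<phi>]]
  have \<sigma>': "\<sigma> \<in> deck_group D" using \<sigma> by (simp add: covers_deck_def)
  have "novikov_map C D \<phi>t (deck_action C \<tau> G) f
      = limit_map ?X ?r ?Y f 0 \<phi>t (limit_map ?X ?r ?X ?r ?u \<tau> (G ?r))"
    by (simp only: novikov_map_component[OF f] deck_action_component[OF r])
  also have "\<dots> = limit_map ?X ?r ?Y f (?u + 0) (\<phi>t \<circ> \<tau>) (G ?r)"
    by (rule limit_map_comp[OF sublevel_map_deck[OF C \<tau> r] sub _ novikov_pi1_component[OF G r]]) simp
  also have "\<dots> = limit_map ?X ?r ?Y f (0 + deck_period D \<sigma>) (\<phi>t \<circ> \<tau>) (G ?r)"
    by (simp add: deck_period_covers[OF C D \<phi> \<tau> \<sigma>])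
  also have "\<dots> = limit_map ?Y f ?Y f (deck_period D \<sigma>) \<sigma> (limit_map ?X ?r ?Y f 0 \<phi>t (G ?r))"
    by (rule limit_map_comp[OF sub sublevel_map_deck[OF D \<sigma>' f] _ novikov_pi1_component[OF G r], symmetric])
      (use \<sigma> in \<open>simp add: covers_deck_def\<close>)
  finally show "novikov_map C D \<phi>t (deck_action C \<tau> G) f = deck_action D \<sigma> (novikov_map C D \<phi>t G) f"
    by (simp only: novikov_map_component[OF f] deck_action_component[OF f])
qed

lemma novikov_map_compose:
  assumes C: "novikov_object C" and D: "novikov_object D" and E: "novikov_object E"
    and \<phi>: "novikov_morphism C D \<phi>t \<phi>" and \<psi>: "novikov_morphism D E \<psi>t \<psi>"
    and G: "G \<in> carrier (novikov_pi1 C)"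
  shows "novikov_map C E (\<psi>t \<circ> \<phi>t) G = novikov_map D E \<psi>t (novikov_map C D \<phi>t G)"
proof (rule extensionalityI[OF novikov_map_extensional novikov_map_extensional])
  let ?X = "mtop (cover C)" and ?Y = "mtop (cover D)" and ?Z = "mtop (cover E)"
  fix f assume f: "f \<in> primitives E"
  let ?g = "restrict (f \<circ> \<psi>t) (points (cover D))"
  let ?h = "restrict (?g \<circ> \<phi>t) (points (cover C))"
  \<comment> \<open>Families are indexed by extensional functions, so both sides must address
    \<open>G\<close> at literally the same index. The inner restriction is invisible because
    \<open>\<phi>t\<close> maps into the points of \<open>cover D\<close>.\<close>
  have h: "restrict (f \<circ> (\<psi>t \<circ> \<phi>t)) (points (cover C)) = ?h"
    using smooth_map_in_points[OF morphism_cover[OF \<phi>]] by (auto simp: fun_eq_iff restrict_def)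
  note g = primitives_compose[OF D E \<psi> f]
  note sub = sublevel_map_restrict[OF morphism_cover[OF \<phi>]] sublevel_map_restrict[OF morphism_cover[OF \<psi>]]
  have "novikov_map D E \<psi>t (novikov_map C D \<phi>t G) f
      = limit_map ?Y ?g ?Z f 0 \<psi>t (limit_map ?X ?h ?Y ?g 0 \<phi>t (G ?h))"
    by (simp only: novikov_map_component[OF f] novikov_map_component[OF g])
  also have "\<dots> = limit_map ?X ?h ?Z f (0 + 0) (\<psi>t \<circ> \<phi>t) (G ?h)"
    by (rule limit_map_comp[OF sub _ novikov_pi1_component[OF G primitives_compose[OF C D \<phi> g]]]) simp
  also have "\<dots> = novikov_map C E (\<psi>t \<circ> \<phi>t) G f"
    by (simp only: novikov_map_component[OF f] h add_0)
  finally show "novikov_map C E (\<psi>t \<circ> \<phi>t) G f = novikov_map D E \<psi>t (novikov_map C D \<phi>t G) f"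
    by (rule sym)
qed

theorem theorem1p2:
  fixes C\<^sub>1 :: "('a1, 'b1, 'e1::euclidean_space) covering_class"
    and C\<^sub>2 :: "('a2, 'b2, 'e2::euclidean_space) covering_class"
    and C\<^sub>3 :: "('a3, 'b3, 'e3::euclidean_space) covering_class"
    and \<phi>t :: "'a1 \<Rightarrow> 'a2" and \<phi> :: "'b1 \<Rightarrow> 'b2"
  assumes "novikov_object C\<^sub>1" and "novikov_object C\<^sub>2"
    and "novikov_morphism C\<^sub>1 C\<^sub>2 \<phi>t \<phi>"
  shows "group_hom (novikov_pi1 C\<^sub>1) (novikov_pi1 C\<^sub>2) (novikov_map C\<^sub>1 C\<^sub>2 \<phi>t) \<and>
         (\<forall>\<tau>\<in>deck_group C\<^sub>1.
           (\<exists>!\<sigma>. covers_deck C\<^sub>1 C\<^sub>2 \<phi>t \<tau> \<sigma>) \<and>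
           (\<forall>g\<in>carrier (novikov_pi1 C\<^sub>1).
              novikov_map C\<^sub>1 C\<^sub>2 \<phi>t (deck_action C\<^sub>1 \<tau> g) =
              deck_action C\<^sub>2 (induced_deck C\<^sub>1 C\<^sub>2 \<phi>t \<tau>) (novikov_map C\<^sub>1 C\<^sub>2 \<phi>t g))) \<and>
         (\<forall>\<psi>t \<psi>. novikov_object C\<^sub>3 \<and> novikov_morphism C\<^sub>2 C\<^sub>3 \<psi>t \<psi> \<longrightarrow>
           novikov_morphism C\<^sub>1 C\<^sub>3 (\<psi>t \<circ> \<phi>t) (\<psi> \<circ> \<phi>) \<and>
           (\<forall>g\<in>carrier (novikov_pi1 C\<^sub>1).
              novikov_map C\<^sub>1 C\<^sub>3 (\<psi>t \<circ> \<phi>t) g =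
              novikov_map C\<^sub>2 C\<^sub>3 \<psi>t (novikov_map C\<^sub>1 C\<^sub>2 \<phi>t g)))"
proof (intro conjI ballI allI impI)
  show "group_hom (novikov_pi1 C\<^sub>1) (novikov_pi1 C\<^sub>2) (novikov_map C\<^sub>1 C\<^sub>2 \<phi>t)"
    using assms by (rule novikov_map_hom)
next
  fix \<tau> assume \<tau>: "\<tau> \<in> deck_group C\<^sub>1"
  show ex1: "\<exists>!\<sigma>. covers_deck C\<^sub>1 C\<^sub>2 \<phi>t \<tau> \<sigma>"
    using assms \<tau> by (rule ex1_covers_deck)
  fix g assume "g \<in> carrier (novikov_pi1 C\<^sub>1)"
  \<comment> \<open>Unique existence turns the definite description in \<open>induced_deck\<close>
    into a transformation that covers \<open>\<tau>\<close>.\<close>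
  with assms \<tau> theI'[OF ex1]
  show "novikov_map C\<^sub>1 C\<^sub>2 \<phi>t (deck_action C\<^sub>1 \<tau> g)
      = deck_action C\<^sub>2 (induced_deck C\<^sub>1 C\<^sub>2 \<phi>t \<tau>) (novikov_map C\<^sub>1 C\<^sub>2 \<phi>t g)"
    unfolding induced_deck_def by (rule novikov_map_equivariant)
next
  fix \<psi>t \<psi> assume "novikov_object C\<^sub>3 \<and> novikov_morphism C\<^sub>2 C\<^sub>3 \<psi>t \<psi>"
  then have \<psi>: "novikov_object C\<^sub>3" "novikov_morphism C\<^sub>2 C\<^sub>3 \<psi>t \<psi>" by auto
  show "novikov_morphism C\<^sub>1 C\<^sub>3 (\<psi>t \<circ> \<phi>t) (\<psi> \<circ> \<phi>)"
    using assms(1,2) \<psi>(1) assms(3) \<psi>(2) by (rule novikov_morphism_compose)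
  fix g assume "g \<in> carrier (novikov_pi1 C\<^sub>1)"
  with assms(1,2) \<psi>(1) assms(3) \<psi>(2)
  show "novikov_map C\<^sub>1 C\<^sub>3 (\<psi>t \<circ> \<phi>t) g = novikov_map C\<^sub>2 C\<^sub>3 \<psi>t (novikov_map C\<^sub>1 C\<^sub>2 \<phi>t g)"
    by (rule novikov_map_compose)
qed

end
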